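(* Let $0<\underline{\sigma}\le\overline{\sigma}<\infty$ and $c\in\mathbb{R}$. The one-sided tail capacity of the G-normal distribution, $$p_1(c;\underline{\sigma},\overline{\sigma}) = \lim_{n\to\infty}\ \sup_{\{\sigma_i\}\in\Sigma(\underline{\sigma},\overline{\sigma})} \mathsf{P}\left(\sqrt n\,\bar X_n>c\right),$$ is $$p_1(c;\underline{\sigma},\overline{\sigma}) = \frac{2}{\overline{\sigma}+\underline{\sigma}}\int_c^\infty\left\{\phi(z/\overline{\sigma})\,\mathbf{1}(z\ge0)+\phi(z/\underline{\sigma})\,\mathbf{1}(z<0)\right\}dz .$$
   Context: $\phi$ is the standard normal density and $\mathbf{1}(\cdot)$ the indicator. Let $\epsilon_1,\epsilon_2,\dots$ be i.i.d. random variables on a probability space $(\Omega,\mathcal F,\mathsf P)$ with $\mathsf E(\epsilon_i)=0$, $\mathsf E(\epsilon_i^2)=1$, $\mathsf E(|\epsilon_i|^3)<\infty$, and let $\mathcal F_i=\sigma(\epsilon_1,\dots,\epsilon_i)$ ($\mathcal F_0$ trivial). $\Sigma(\underline{\sigma},\overline{\sigma})$ is the collection of all sequences $\{\sigma_i\}$ that are predictable (each $\sigma_i$ is $\mathcal F_{i-1}$-measurable) and take values in $[\underline{\sigma},\overline{\sigma}]$. For such a sequence, $X_i=\sigma_i\epsilon_i$ and $\bar X_n=(X_1+\cdots+X_n)/n$. *)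

theory Defs
  imports "HOL-Probability.Probability"
begin

text \<open>
  Sequences are indexed by \<^typ>\<open>nat\<close>, but only the indices \<open>i \<ge> 1\<close> carry meaning;
  nothing is assumed about the entry at index \<open>0\<close>.
\<close>

definition iid_standardized :: "'a measure \<Rightarrow> (nat \<Rightarrow> 'a \<Rightarrow> real) \<Rightarrow> bool" where
  "iid_standardized M \<epsilon> \<longleftrightarrow>
     prob_space M \<and>
     prob_space.indep_vars M (\<lambda>_. borel) \<epsilon> {1..} \<and>
     (\<forall>i\<ge>1. distr M borel (\<epsilon> i) = distr M borel (\<epsilon> 1)) \<and>
     (\<forall>i\<ge>1. integrable M (\<lambda>\<omega>. \<bar>\<epsilon> i \<omega>\<bar> ^ 3) \<and>
             (LINT \<omega>|M. \<epsilon> i \<omega>) = 0 \<and>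
             (LINT \<omega>|M. (\<epsilon> i \<omega>)\<^sup>2) = 1)"

text \<open>For \<open>i = 0\<close> the generating family is empty and the sigma-algebra is the trivial one.\<close>

definition noise_filtration :: "'a measure \<Rightarrow> (nat \<Rightarrow> 'a \<Rightarrow> real) \<Rightarrow> nat \<Rightarrow> 'a measure" where
  "noise_filtration M \<epsilon> i =
     sigma (space M) (\<Union>j\<in>{1..i}. {\<epsilon> j -` A \<inter> space M | A. A \<in> sets borel})"

definition predictable_controls ::
    "'a measure \<Rightarrow> (nat \<Rightarrow> 'a \<Rightarrow> real) \<Rightarrow> real \<Rightarrow> real \<Rightarrow> (nat \<Rightarrow> 'a \<Rightarrow> real) set" where
  "predictable_controls M \<epsilon> lo hi =
     {\<sigma>. \<forall>i\<ge>1. \<sigma> i \<in> borel_measurable (noise_filtration M \<epsilon> (i - 1)) \<and>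
              (\<forall>\<omega>\<in>space M. \<sigma> i \<omega> \<in> {lo..hi})}"

definition controlled_mean ::
    "(nat \<Rightarrow> 'a \<Rightarrow> real) \<Rightarrow> (nat \<Rightarrow> 'a \<Rightarrow> real) \<Rightarrow> nat \<Rightarrow> 'a \<Rightarrow> real" where
  "controlled_mean \<epsilon> \<sigma> n \<omega> = (\<Sum>i=1..n. \<sigma> i \<omega> * \<epsilon> i \<omega>) / real n"

definition upper_tail_prob ::
    "'a measure \<Rightarrow> (nat \<Rightarrow> 'a \<Rightarrow> real) \<Rightarrow> real \<Rightarrow> real \<Rightarrow> real \<Rightarrow> nat \<Rightarrow> real" where
  "upper_tail_prob M \<epsilon> lo hi c n =
     (SUP \<sigma>\<in>predictable_controls M \<epsilon> lo hi.
        measure M {\<omega> \<in> space M. sqrt (real n) * controlled_mean \<epsilon> \<sigma> n \<omega> > c})"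

text \<open>
  \<^const>\<open>lim\<close> is unspecified for divergent sequences, so a statement about this value is
  meaningful only together with \<^const>\<open>convergent\<close>.
\<close>

definition tail_capacity ::
    "'a measure \<Rightarrow> (nat \<Rightarrow> 'a \<Rightarrow> real) \<Rightarrow> real \<Rightarrow> real \<Rightarrow> real \<Rightarrow> real" where
  "tail_capacity M \<epsilon> lo hi c = lim (upper_tail_prob M \<epsilon> lo hi c)"

end

(* The function u(t,x) = F((c - x) / sqrt t), with F the claimed formula as a function of c, solves the
   G-heat equation u_t = sup {s^2 u_xx / 2 | lo <= s <= hi} with the indicator of (c, infinity) as
   initial value: u is convex in x left of c and concave right of c. Since the profile has a continuous
   derivative at 0, F'' is Lipschitz, so for t bounded away from 0 a step of size 1/sqrt n costs only
   O(n^(-3/2)) in a Taylor expansion. Along every control E u decreases up to this error, and along the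
   feedback control "hi below c, lo above c" it is constant up to this error (Lindeberg telescoping).
   Starting the flow at a small time h and shifting c by h^(1/4) sandwiches the indicator. *)
theory Submission
  imports Defs
begin

section \<open>The similarity solution of the G-heat equation\<close>

text \<open>For u(t,x) = F(z) with z = (c - x) / sqrt t the equation becomes v(z)^2 F''(z) = - z
  F'(z), where v is hi for z >= 0 and lo for z < 0. On each half-line this makes F' a multiple of
  phi(z / v). Both Gaussians have the value phi(0) at 0, so continuity of F' forces one common
  factor, and total mass 1 forces this factor to be 2 / (hi + lo) up to sign. The obstacle is that
  the optimal volatility jumps at x = c. It jumps exactly where u_xx vanishes, so u_xx stays
  Lipschitz in x, and the explicit formula replaces any regularity theory for the nonlinear
  equation. The one-step error constants blow up as h tends to 0, like h^(-3/2) from space and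
  h^(-2) from time. Hence h is fixed first, then n tends to infinity: n errors of order n^(-3/2) add
  up to n^(-1/2). The shift h^(1/4) is small itself, yet it exceeds the smoothing width sqrt h by
  the factor h^(-1/4), so at this distance from the jump F is already close to 0 or 1.\<close>

lemma std_normal_density_scaled_has_derivative:
  assumes "b \<noteq> 0"
  shows "((\<lambda>z. std_normal_density (z / b)) has_real_derivative
           - (z / b\<^sup>2) * std_normal_density (z / b)) (at z within S)"
  unfolding std_normal_density_def using assms
  by (auto intro!: derivative_eq_intros simp: power2_eq_square field_simps)

text \<open>The single source of all polynomial-times-Gaussian estimates below. The quadratic Taylor
  bound of exp at w^2 / 2 has the leading term w^4 / 8, whence the 8; the factor 1 / sqrt (2 * pi)
  is just bounded by 1.\<close>

lemma std_normal_density_quartic_bound: "(1 + w\<^sup>2)\<^sup>2 * std_normal_density w \<le> 8"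
proof -
  have e: "exp (w\<^sup>2 / 2) \<ge> 1 + w\<^sup>2 / 2 + (w\<^sup>2 / 2)\<^sup>2 / 2"
    by (rule exp_lower_Taylor_quadratic) simp
  have "(1 + w\<^sup>2)\<^sup>2 \<le> 8 * (1 + w\<^sup>2 / 2 + (w\<^sup>2 / 2)\<^sup>2 / 2)"
    by (simp add: power2_eq_square algebra_simps)
  also have "\<dots> \<le> 8 * exp (w\<^sup>2 / 2)"
    using e by (intro mult_left_mono) auto
  finally have "(1 + w\<^sup>2)\<^sup>2 \<le> 8 * exp (w\<^sup>2 / 2)" .
  then have A: "(1 + w\<^sup>2)\<^sup>2 * exp (- (w\<^sup>2 / 2)) \<le> 8"
    by (simp add: exp_minus field_simps)
  have "1 \<le> sqrt (2 * pi)"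
    using pi_gt3 by (intro real_le_rsqrt) simp
  then have "1 / sqrt (2 * pi) \<le> 1" by simp
  then have "(1 + w\<^sup>2)\<^sup>2 * exp (- (w\<^sup>2 / 2)) * (1 / sqrt (2 * pi)) \<le> 8 * 1"
    using A by (intro mult_mono) auto
  then show ?thesis by (simp add: std_normal_density_def mult_ac)
qed

lemma lipschitz_from_bounded_derivative:
  fixes f f' :: "real \<Rightarrow> real"
  assumes "\<And>z. z \<in> {a..b} \<Longrightarrow> (f has_real_derivative f' z) (at z)"
    and "\<And>z. z \<in> {a..b} \<Longrightarrow> \<bar>f' z\<bar> \<le> L" and "a \<le> b"
  shows "\<bar>f b - f a\<bar> \<le> L * (b - a)"
proof (cases "a = b")
  case False
  then obtain z where "a < z" "z < b" "f b - f a = (b - a) * f' z"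
    using MVT2[of a b f f'] assms by auto
  then have "\<bar>f b - f a\<bar> = \<bar>f' z\<bar> * (b - a)" using assms(3) by (simp add: abs_mult)
  also have "\<dots> \<le> L * (b - a)"
    using assms(2)[of z] \<open>a < z\<close> \<open>z < b\<close> by (intro mult_right_mono) auto
  finally show ?thesis .
qed simp

text \<open>Phrased with a Lipschitz second derivative because \<open>curv\<close>, to which it is
  applied, has a kink at 0 when lo < hi. The mean value bound is used twice on the ball of radius
  \<open>\<bar>d\<bar>\<close>, first for the remainder of f' and then for that of f; this costs the
  factor 1/6 of the sharp constant.\<close>

lemma second_order_remainder_bound:
  fixes f f' f'' :: "real \<Rightarrow> real"
  assumes f: "\<And>z. (f has_real_derivative f' z) (at z)"
    and f': "\<And>z. (f' has_real_derivative f'' z) (at z)"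
    and lip: "\<And>u v. \<bar>f'' u - f'' v\<bar> \<le> L * \<bar>u - v\<bar>" and "0 \<le> L"
  shows "\<bar>f (s + d) - f s - f' s * d - f'' s * d\<^sup>2 / 2\<bar> \<le> L * \<bar>d\<bar> ^ 3"
proof -
  define r where "r z = f (s + z) - f s - f' s * z - f'' s * z\<^sup>2 / 2" for z
  define r' where "r' z = f' (s + z) - f' s - f'' s * z" for z
  have sh: "((\<lambda>z. g (s + z)) has_real_derivative g' (s + z)) (at z)"
    if "\<And>z. (g has_real_derivative g' z) (at z)" for g g' :: "real \<Rightarrow> real" and z
    using DERIV_shift[of g "g' (s + z)" z s] that[of "s + z"] by (simp add: add.commute)
  have r: "(r has_real_derivative r' z) (at z)" for z
    unfolding r_def r'_def
    by (auto intro!: derivative_eq_intros sh[OF f])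
  have r': "(r' has_real_derivative f'' (s + z) - f'' s) (at z)" for z
    unfolding r'_def
    by (auto intro!: derivative_eq_intros sh[OF f'])
  have b1: "\<bar>r' z\<bar> \<le> L * d\<^sup>2" if "\<bar>z\<bar> \<le> \<bar>d\<bar>" for z
  proof -
    have "norm (r' z - r' 0) \<le> (L * \<bar>d\<bar>) * norm (z - 0)"
    proof (rule field_differentiable_bound[of "cball 0 \<bar>d\<bar>" r' "\<lambda>z. f'' (s + z) - f'' s"])
      fix w :: real assume "w \<in> cball 0 \<bar>d\<bar>"
      then have "\<bar>w\<bar> \<le> \<bar>d\<bar>" by simp
      then show "norm (f'' (s + w) - f'' s) \<le> L * \<bar>d\<bar>"
        using lip[of "s + w" s] mult_left_mono[of "\<bar>w\<bar>" "\<bar>d\<bar>" L] \<open>0 \<le> L\<close> by simp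
    qed (use that in \<open>auto intro: r' DERIV_subset\<close>)
    then have "\<bar>r' z\<bar> \<le> (L * \<bar>d\<bar>) * \<bar>z\<bar>" by (simp add: r'_def)
    also have "\<dots> \<le> (L * \<bar>d\<bar>) * \<bar>d\<bar>" using that \<open>0 \<le> L\<close> by (intro mult_left_mono) auto
    finally show ?thesis by (simp add: power2_eq_square abs_mult[symmetric] mult.assoc)
  qed
  have "norm (r d - r 0) \<le> (L * d\<^sup>2) * norm (d - 0)"
    by (rule field_differentiable_bound[of "cball 0 \<bar>d\<bar>" r r'])
       (auto intro: r DERIV_subset b1)
  moreover have "(L * d\<^sup>2) * \<bar>d\<bar> = L * \<bar>d\<bar> ^ 3"
    by (simp add: power2_eq_square power3_eq_cube abs_mult[symmetric] mult_ac)
  ultimately show ?thesis by (simp add: r_def)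
qed

text \<open>Reflection shows that both half-lines carry the same mass, and the point 0 is null, so
  each has 1/2. Half-lines are invariant under scaling by b > 0, so the substitution z / b only
  contributes the factor b.\<close>

lemma half_line_normal_integral:
  assumes "0 < b"
  shows "has_bochner_integral lborel (\<lambda>z. std_normal_density (z / b) * indicator {0..} z) (b / 2)"
    and "has_bochner_integral lborel (\<lambda>z. std_normal_density (z / b) * indicator {..<0} z) (b / 2)"
proof -
  define I where "I A = (LINT z|lborel. std_normal_density z * indicator A z)" for A :: "real set"
  have int: "integrable lborel (\<lambda>z. std_normal_density z * indicator A z)"
    if "A \<in> sets borel" for A
    using that by (intro integrable_real_mult_indicator) auto
  have neg: "I {..<0} = I {0<..}"
    unfolding I_def
    by (subst lborel_integral_real_affine[where c = "-1" and t = 0])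
       (auto simp: std_normal_density_def indicator_def intro!: Bochner_Integration.integral_cong)
  have zero: "I {0..} = I {0<..}"
    unfolding I_def
    by (rule integral_cong_AE) (use AE_lborel_singleton[of 0] in \<open>auto simp: indicator_def\<close>)
  have "I {0..} + I {..<0} = (LINT z|lborel. std_normal_density z)"
    unfolding I_def
    by (subst Bochner_Integration.integral_add[OF int int, symmetric])
       (auto simp: indicator_def simp del: integral_normal_density intro!: Bochner_Integration.integral_cong)
  then have half: "I {0..} = 1 / 2" "I {..<0} = 1 / 2"
    using neg zero by auto
  have scale: "has_bochner_integral lborel (\<lambda>z. std_normal_density (z / b) * indicator A z) (b * I A)"
    if "A \<in> sets borel" and A: "\<And>z. z / b \<in> A \<longleftrightarrow> z \<in> A" for A
  proof -
    have "has_bochner_integral lborel (\<lambda>z. std_normal_density z * indicator A z) (I A)"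
      unfolding I_def using int[OF that(1)] by (rule has_bochner_integral_integrable)
    then have "has_bochner_integral lborel
        (\<lambda>z. std_normal_density (0 + (1 / b) * z) * indicator A (0 + (1 / b) * z)) (I A /\<^sub>R \<bar>1 / b\<bar>)"
      using assms by (subst (asm) lborel_has_bochner_integral_real_affine_iff[where c = "1 / b" and t = 0]) auto
    then show ?thesis using assms A by (simp add: indicator_def)
  qed
  show "has_bochner_integral lborel (\<lambda>z. std_normal_density (z / b) * indicator {0..} z) (b / 2)"
    using scale[of "{0..}"] half assms by (simp add: zero_le_divide_iff)
  show "has_bochner_integral lborel (\<lambda>z. std_normal_density (z / b) * indicator {..<0} z) (b / 2)"
    using scale[of "{..<0}"] half assms by (simp add: divide_less_0_iff)
qed

section \<open>The two-piece Gaussian profile and its tail\<close>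

locale volatility_band =
  fixes lo hi :: real
  assumes lo_pos: "0 < lo" and lo_le_hi: "lo \<le> hi"
begin

lemma hi_pos: "0 < hi"
  using lo_pos lo_le_hi by linarith

text \<open>The argument is the similarity variable (c - x) / sqrt t, whose sign tells the side of c
  on which x lies. The value is a maximiser of s^2 u_xx / 2 over the band.\<close>

definition vol :: "real \<Rightarrow> real" where
  "vol z = (if 0 \<le> z then hi else lo)"

definition profile :: "real \<Rightarrow> real" where
  "profile z = std_normal_density (z / hi) * indicator {0..} z +
               std_normal_density (z / lo) * indicator {..<0} z"

definition tail :: "real \<Rightarrow> real" where
  "tail y = 2 / (hi + lo) * (LINT z:{y<..}|lborel. profile z)"

definition slope :: "real \<Rightarrow> real" where
  "slope z = - (2 / (hi + lo)) * profile z"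

text \<open>With \<open>tail\<close> as F, \<open>slope\<close> is F' and \<open>curv\<close> is
  F''. The formulas make \<open>(vol z)\<^sup>2 * curv z = - z * slope z\<close> hold, which is the
  G-heat equation for a function of (c - x) / sqrt t.\<close>

definition curv :: "real \<Rightarrow> real" where
  "curv z = 2 / (hi + lo) * (z / (vol z)\<^sup>2) * profile z"

lemma vol_bounds: "lo \<le> vol z" "vol z \<le> hi" "0 < vol z"
  using lo_pos lo_le_hi by (auto simp: vol_def)

lemma profile_eq: "profile z = std_normal_density (z / vol z)"
  by (simp add: profile_def vol_def)

lemma profile_nonneg: "0 \<le> profile z"
  by (simp add: profile_eq)

text \<open>The branches glue at 0, the only common point of the two closures: since the densities
  are not divided by their scale, both have the value phi(0) there, and both have derivative
  0.\<close>

lemma profile_has_derivative: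
  "(profile has_real_derivative - (z / (vol z)\<^sup>2) * profile z) (at z)"
proof -
  have "((\<lambda>z. if z \<in> {0..} then std_normal_density (z / hi) else std_normal_density (z / lo))
     has_vector_derivative (if z \<in> {0..} then - (z / hi\<^sup>2) * std_normal_density (z / hi)
        else - (z / lo\<^sup>2) * std_normal_density (z / lo))) (at z within UNIV)"
  proof (rule has_vector_derivative_If_within_closures[where T = "{..<0}"])
    show "((\<lambda>z. std_normal_density (z / hi)) has_vector_derivative
        - (z / hi\<^sup>2) * std_normal_density (z / hi)) (at z within {0..} \<union> closure {0..} \<inter> closure {..<0})"
      using std_normal_density_scaled_has_derivative[of hi] hi_pos
      by (simp add: has_real_derivative_iff_has_vector_derivative)
    show "((\<lambda>z. std_normal_density (z / lo)) has_vector_derivative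
        - (z / lo\<^sup>2) * std_normal_density (z / lo)) (at z within {..<0} \<union> closure {0..} \<inter> closure {..<0})"
      using std_normal_density_scaled_has_derivative[of lo] lo_pos
      by (simp add: has_real_derivative_iff_has_vector_derivative)
  qed auto
  moreover have "(\<lambda>z. if z \<in> {0..} then std_normal_density (z / hi) else std_normal_density (z / lo)) = profile"
    by (auto simp: profile_eq vol_def fun_eq_iff)
  ultimately show ?thesis
    unfolding has_real_derivative_iff_has_vector_derivative
    by (simp add: profile_eq vol_def split: if_splits)
qed

lemma slope_has_derivative: "(slope has_real_derivative curv z) (at z)"
  unfolding slope_def[abs_def] curv_def
  using DERIV_cmult[OF profile_has_derivative, of "- (2 / (hi + lo))" z]
  by (simp add: mult_ac)

lemma profile_measurable [measurable]: "profile \<in> borel_measurable borel"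
  unfolding profile_def[abs_def] by measurable

lemma profile_integral: "has_bochner_integral lborel profile ((hi + lo) / 2)"
  using has_bochner_integral_add[OF half_line_normal_integral(1)[OF hi_pos]
      half_line_normal_integral(2)[OF lo_pos]]
  by (simp add: profile_def[abs_def] add_divide_distrib)

text \<open>The split normal law with mode 0. As a probability measure it hands down to
  \<open>tail\<close> the bounds, monotonicity and limits at infinity of distribution
  functions.\<close>

definition limit_law :: "real measure" where
  "limit_law = density lborel (\<lambda>z. ennreal (2 / (hi + lo) * profile z))"

lemma limit_law_prob: "real_distribution limit_law"
proof -
  have "has_bochner_integral lborel (\<lambda>z. 2 / (hi + lo) * profile z) (2 / (hi + lo) * ((hi + lo) / 2))"
    by (intro has_bochner_integral_mult_right profile_integral)
  also have "2 / (hi + lo) * ((hi + lo) / 2) = 1"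
    using hi_pos lo_pos by (simp add: field_simps)
  finally have I: "has_bochner_integral lborel (\<lambda>z. 2 / (hi + lo) * profile z) 1" .
  have "(\<integral>\<^sup>+z. ennreal (2 / (hi + lo) * profile z) \<partial>lborel) = ennreal 1"
    using I hi_pos lo_pos profile_nonneg unfolding has_bochner_integral_iff
    by (subst nn_integral_eq_integral) auto
  then have "emeasure limit_law (space limit_law) = 1"
    unfolding limit_law_def by (subst emeasure_density) auto
  then interpret prob_space limit_law by (rule prob_spaceI)
  show ?thesis by unfold_locales (auto simp: limit_law_def)
qed

lemma tail_eq: "tail y = 1 - cdf limit_law y"
proof -
  interpret real_distribution limit_law by (rule limit_law_prob)
  have "integrable lborel (\<lambda>z. 2 / (hi + lo) * (profile z * indicator {y<..} z))"
    using profile_integral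
    by (intro integrable_mult_right integrable_real_mult_indicator) (auto simp: has_bochner_integral_iff)
  then have "(\<integral>\<^sup>+z. ennreal (2 / (hi + lo) * (profile z * indicator {y<..} z)) \<partial>lborel)
      = ennreal (LINT z|lborel. 2 / (hi + lo) * (profile z * indicator {y<..} z))"
    using hi_pos lo_pos profile_nonneg by (intro nn_integral_eq_integral) auto
  moreover have "emeasure limit_law {y<..} =
      (\<integral>\<^sup>+z. ennreal (2 / (hi + lo) * (profile z * indicator {y<..} z)) \<partial>lborel)"
    unfolding limit_law_def
    by (subst emeasure_density) (auto intro!: nn_integral_cong split: split_indicator)
  moreover have "(LINT z|lborel. 2 / (hi + lo) * (profile z * indicator {y<..} z)) = tail y"
    by (simp add: tail_def set_lebesgue_integral_def mult.commute)
  moreover have "0 \<le> tail y"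
    unfolding tail_def set_lebesgue_integral_def using hi_pos lo_pos profile_nonneg
    by (intro mult_nonneg_nonneg integral_nonneg) auto
  ultimately have "measure limit_law {y<..} = tail y"
    by (simp add: measure_def)
  moreover have "measure limit_law {y<..} = 1 - measure limit_law {..y}"
    using prob_compl[of "{..y}"] by (simp add: limit_law_def Compl_eq_Diff_UNIV[symmetric])
  ultimately show ?thesis by (simp add: cdf_def2)
qed

lemma tail_bounds: "0 \<le> tail y" "tail y \<le> 1"
proof -
  interpret real_distribution limit_law by (rule limit_law_prob)
  show "0 \<le> tail y" "tail y \<le> 1" using cdf_bounded_prob cdf_nonneg by (simp_all add: tail_eq)
qed

lemma tail_antimono: "x \<le> y \<Longrightarrow> tail y \<le> tail x"
proof -
  interpret real_distribution limit_law by (rule limit_law_prob)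
  show "x \<le> y \<Longrightarrow> tail y \<le> tail x" using cdf_nondecreasing by (simp add: tail_eq)
qed

lemma tail_limits: "(tail \<longlongrightarrow> 0) at_top" "(tail \<longlongrightarrow> 1) at_bot"
proof -
  interpret real_distribution limit_law by (rule limit_law_prob)
  have "((\<lambda>y. 1 - cdf limit_law y) \<longlongrightarrow> 1 - 1) at_top"
    by (intro tendsto_intros cdf_lim_at_top_prob)
  then show "(tail \<longlongrightarrow> 0) at_top" by (simp add: tail_eq[abs_def])
  have "((\<lambda>y. 1 - cdf limit_law y) \<longlongrightarrow> 1 - 0) at_bot"
    by (intro tendsto_intros cdf_lim_at_bot)
  then show "(tail \<longlongrightarrow> 1) at_bot" by (simp add: tail_eq[abs_def])
qed

section \<open>Smoothness of the tail in space and time\<close>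

lemma tail_has_derivative: "(tail has_real_derivative slope z) (at z)"
proof -
  have sint: "set_integrable lborel A profile" if "A \<in> sets borel" for A
    using profile_integral that unfolding set_integrable_def has_bochner_integral_iff
    by (intro integrable_mult_indicator) auto
  \<comment> \<open>The fundamental theorem of calculus concerns bounded intervals, so the variable
    end of the half-line is split off at the base point z - 1, which leaves a constant.\<close>
  have split: "tail u = tail (z - 1) + - (2 / (hi + lo)) * (LBINT y=z-1..u. profile y)" if "z - 1 < u" for u
  proof -
    have "(LINT y:{z-1<..}|lborel. profile y) = (LINT y:{z-1<..u}|lborel. profile y) + (LINT y:{u<..}|lborel. profile y)"
    proof -
      have "{z-1<..} = {z-1<..u} \<union> {u<..}" using that by auto
      moreover have "(LINT y:{z-1<..u} \<union> {u<..}|lborel. profile y)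
          = (LINT y:{z-1<..u}|lborel. profile y) + (LINT y:{u<..}|lborel. profile y)"
        by (rule set_integral_Un) (auto intro: sint)
      ultimately show ?thesis by (rule ssubst)
    qed
    moreover have "(LBINT y=z-1..u. profile y) = (LINT y:{z-1<..u}|lborel. profile y)"
      using that by (subst interval_integral_Ioc) auto
    ultimately show ?thesis unfolding tail_def by (simp add: algebra_simps)
  qed
  have cont: "continuous_on A profile" for A
    using profile_has_derivative by (meson DERIV_isCont continuous_at_imp_continuous_on)
  have "((\<lambda>u. LBINT y=z-1..u. profile y) has_vector_derivative profile z) (at z within {z-1..z+1})"
    by (rule interval_integral_FTC2) (auto intro: cont)
  then have "((\<lambda>u. LBINT y=z-1..u. profile y) has_real_derivative profile z) (at z within {z-1..z+1})"
    by (simp add: has_real_derivative_iff_has_vector_derivative)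
  then have "((\<lambda>u. LBINT y=z-1..u. profile y) has_real_derivative profile z) (at z)"
    using at_within_interior[of z "{z-1..z+1}"] by (simp only: interior_atLeastAtMost_real) simp
  then have "((\<lambda>u. tail (z - 1) + - (2 / (hi + lo)) * (LBINT y=z-1..u. profile y)) has_real_derivative slope z) (at z)"
    unfolding slope_def
    using DERIV_add[OF DERIV_const[of "tail (z - 1)"] DERIV_cmult[of _ "profile z" z UNIV "- (2 / (hi + lo))"]]
    by (simp only: add_0)
  then show ?thesis
    by (rule has_field_derivative_transform_within_open[where S = "{z-1<..}"]) (auto simp: split)
qed

text \<open>On each half-line \<open>curv\<close> is a smooth function \<open>g b\<close> whose
  derivative is K / b^2 times (1 - w^2) phi(w) with w = z / b. This is at most 8 * K / lo^2 for b =
  lo and b = hi alike.\<close>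

lemma curv_lipschitz: "\<bar>curv u - curv v\<bar> \<le> 16 / ((hi + lo) * lo\<^sup>2) * \<bar>u - v\<bar>"
proof -
  define K where "K = 2 / (hi + lo)"
  define g where "g b z = K * (z / b\<^sup>2) * std_normal_density (z / b)" for b z
  define L where "L = 8 * K / lo\<^sup>2"
  have K: "0 < K" using hi_pos lo_pos by (simp add: K_def)
  have g: "\<bar>g b y - g b x\<bar> \<le> L * (y - x)" if "lo \<le> b" "x \<le> y" for b x y
  proof (rule lipschitz_from_bounded_derivative)
    have b: "0 < b" using that lo_pos by simp
    fix z
    show "(g b has_real_derivative
        K * ((1 / b\<^sup>2) * std_normal_density (z / b) + (- (z / b\<^sup>2) * std_normal_density (z / b)) * (z / b\<^sup>2))) (at z)"
    proof -
      have "((\<lambda>z. K * (z / b\<^sup>2 * std_normal_density (z / b))) has_real_derivative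
        K * ((1 / b\<^sup>2) * std_normal_density (z / b) + (- (z / b\<^sup>2) * std_normal_density (z / b)) * (z / b\<^sup>2))) (at z)"
        using b by (intro DERIV_cmult DERIV_mult DERIV_cdivide DERIV_ident
            std_normal_density_scaled_has_derivative) auto
      then show ?thesis by (simp only: g_def[abs_def] mult.assoc)
    qed
    define w where "w = z / b"
    have "K * ((1 / b\<^sup>2) * std_normal_density (z / b) + (- (z / b\<^sup>2) * std_normal_density (z / b)) * (z / b\<^sup>2))
        = K / b\<^sup>2 * ((1 - w\<^sup>2) * std_normal_density w)"
      using b by (simp add: w_def field_simps power2_eq_square)
    also have "\<bar>\<dots>\<bar> = K / b\<^sup>2 * (\<bar>1 - w\<^sup>2\<bar> * std_normal_density w)"
      using K by (simp add: abs_mult)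
    also have "\<dots> \<le> K / b\<^sup>2 * 8"
    proof -
      have "\<bar>1 - w\<^sup>2\<bar> \<le> 1 + w\<^sup>2" by (simp add: abs_le_iff)
      also have "\<dots> \<le> (1 + w\<^sup>2)\<^sup>2" by (rule self_le_power) auto
      finally have "\<bar>1 - w\<^sup>2\<bar> \<le> (1 + w\<^sup>2)\<^sup>2" .
      then have "\<bar>1 - w\<^sup>2\<bar> * std_normal_density w \<le> (1 + w\<^sup>2)\<^sup>2 * std_normal_density w"
        by (intro mult_right_mono) auto
      then show ?thesis
        using std_normal_density_quartic_bound[of w] K by (intro mult_left_mono) auto
    qed
    also have "\<dots> \<le> K / lo\<^sup>2 * 8"
      using that(1) lo_pos K by (intro mult_right_mono divide_left_mono power_mono) auto
    finally show "\<bar>K * ((1 / b\<^sup>2) * std_normal_density (z / b) + (- (z / b\<^sup>2) * std_normal_density (z / b)) * (z / b\<^sup>2))\<bar> \<le> L"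
      by (simp add: L_def mult.commute)
  qed (rule that)
  have curv_g: "curv z = g (vol z) z" for z
    by (simp add: curv_def g_def profile_eq K_def)
  have main: "\<bar>curv y - curv x\<bar> \<le> L * (y - x)" if "x \<le> y" for x y
  proof (cases "x < 0 \<and> 0 \<le> y")
    case True
    \<comment> \<open>Across the kink the increment is cut at 0, where both branches vanish; the two
      pieces then add up with the same constant.\<close>
    have "g b 0 = 0" for b by (simp add: g_def)
    then have "\<bar>curv y\<bar> \<le> L * y" "\<bar>curv x\<bar> \<le> L * (- x)"
      using g[of hi 0 y] g[of lo x 0] True lo_le_hi by (auto simp: curv_g vol_def)
    then show ?thesis by (simp add: right_diff_distrib)
  next
    case False
    then have "vol x = vol y" using that by (auto simp: vol_def)
    then show ?thesis using g[of "vol y" x y] vol_bounds that by (simp add: curv_g)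
  qed
  have "16 / ((hi + lo) * lo\<^sup>2) = L"
    by (simp add: L_def K_def)
  then show ?thesis
    using main[of u v] main[of v u] by (cases "u \<le> v") (auto simp: abs_minus_commute)
qed

text \<open>The coefficient of p is the time derivative, rewritten by the G-heat equation as
  \<open>vol\<close> squared times half the second space derivative. The error is a bound on the
  second time derivative that is uniform in z, because the Gaussian absorbs every power of z / sqrt
  r.\<close>

lemma time_expansion:
  assumes "0 < t" "0 < p"
  shows "\<bar>tail (z / sqrt (t + p)) - tail (z / sqrt t)
            - p * (curv (z / sqrt t) * (vol (z / sqrt t))\<^sup>2 / (2 * t))\<bar>
         \<le> 16 * hi / (hi + lo) / t\<^sup>2 * p\<^sup>2"
proof -
  define K where "K = 2 / (hi + lo)"
  define w where "w r = z / sqrt r" for r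
  define H where "H r = tail (w r)" for r
  define H' where "H' r = K / 2 * (w r * profile (w r) / r)" for r
  define M where "M = 8 * K * hi / t\<^sup>2"
  have K: "0 < K" using hi_pos lo_pos by (simp add: K_def)
  have w: "(w has_real_derivative - (w r / (2 * r))) (at r)" if "0 < r" for r
    unfolding w_def[abs_def] using that
    by (auto intro!: derivative_eq_intros simp: field_simps)
  have H: "(H has_real_derivative H' r) (at r)" if "0 < r" for r
  proof -
    have "(H has_real_derivative slope (w r) * - (w r / (2 * r))) (at r)"
      unfolding H_def[abs_def] by (rule DERIV_chain2[OF tail_has_derivative w[OF that]])
    moreover have "slope (w r) * - (w r / (2 * r)) = H' r"
      by (simp add: H'_def slope_def flip: K_def)
    ultimately show ?thesis by simp
  qed
  define D where "D r = K / 2 * (profile (w r) / r\<^sup>2 * (w r * ((w r / vol (w r))\<^sup>2 / 2 - 3 / 2)))" for r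
  have H': "(H' has_real_derivative D r) (at r)" if "0 < r" for r
  proof -
    have p: "((\<lambda>r. profile (w r)) has_real_derivative
        (- (w r / (vol (w r))\<^sup>2) * profile (w r)) * - (w r / (2 * r))) (at r)"
      by (rule DERIV_chain2[OF profile_has_derivative w[OF that]])
    have "(H' has_real_derivative K / 2 * (
        (((- (w r / (2 * r))) * profile (w r) + ((- (w r / (vol (w r))\<^sup>2) * profile (w r)) * - (w r / (2 * r))) * w r) * r
          - w r * profile (w r) * 1) / (r * r))) (at r)"
      unfolding H'_def[abs_def]
      by (intro DERIV_cmult DERIV_divide DERIV_mult p w DERIV_ident) (use that in auto)
    moreover have "K / 2 * (
        (((- (w r / (2 * r))) * profile (w r) + ((- (w r / (vol (w r))\<^sup>2) * profile (w r)) * - (w r / (2 * r))) * w r) * r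
          - w r * profile (w r) * 1) / (r * r)) = D r"
      using that vol_bounds(3)[of "w r"] unfolding D_def
      by (simp add: field_simps power2_eq_square)
    ultimately show ?thesis by simp
  qed
  have D: "\<bar>D r\<bar> \<le> M" if "t \<le> r" for r
  proof -
    \<comment> \<open>In the variable q, \<open>D r\<close> is K * v / (2 * r^2) times phi(q) * q *
      (q^2 / 2 - 3 / 2). The cubic is dominated by 2 * (1 + q^2)^2, so the quartic bound gives
      16.\<close>
    define v where "v = vol (w r)"
    define q where "q = w r / v"
    have v: "0 < v" "v \<le> hi" using vol_bounds by (auto simp: v_def)
    have q: "w r = v * q" using v by (simp add: q_def)
    have "\<bar>q * (q\<^sup>2 / 2 - 3 / 2)\<bar> \<le> 2 * (1 + q\<^sup>2)\<^sup>2"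
    proof -
      have "0 \<le> (\<bar>q\<bar> - 1)\<^sup>2" by simp
      then have "\<bar>q\<bar> \<le> 1 + q\<^sup>2" by (simp add: power2_eq_square algebra_simps)
      moreover have "\<bar>q\<^sup>2 / 2 - 3 / 2\<bar> \<le> 2 * (1 + q\<^sup>2)"
      proof -
        have "\<bar>x / 2 - 3 / 2\<bar> \<le> 2 * (1 + x)" if "0 \<le> x" for x :: real
          using that by (auto simp: abs_le_iff field_simps)
        then show ?thesis by simp
      qed
      ultimately have "\<bar>q\<bar> * \<bar>q\<^sup>2 / 2 - 3 / 2\<bar> \<le> (1 + q\<^sup>2) * (2 * (1 + q\<^sup>2))"
        by (intro mult_mono) auto
      also have "\<dots> = 2 * (1 + q\<^sup>2)\<^sup>2" by (simp add: power2_eq_square[of "1 + q\<^sup>2"])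
      finally show ?thesis by (simp add: abs_mult)
    qed
    then have "std_normal_density q * \<bar>q * (q\<^sup>2 / 2 - 3 / 2)\<bar> \<le> std_normal_density q * (2 * (1 + q\<^sup>2)\<^sup>2)"
      by (intro mult_left_mono) auto
    also have "\<dots> \<le> 16" using std_normal_density_quartic_bound[of q] by (simp add: mult_ac)
    finally have *: "std_normal_density q * \<bar>q * (q\<^sup>2 / 2 - 3 / 2)\<bar> \<le> 16" .
    have "\<bar>D r\<bar> = K / 2 / r\<^sup>2 * (v * (std_normal_density q * \<bar>q * (q\<^sup>2 / 2 - 3 / 2)\<bar>))"
    proof -
      have "profile (w r) = std_normal_density q" by (simp add: profile_eq q_def v_def)
      then have "D r = K / 2 * (std_normal_density q / r\<^sup>2 * (v * q * (q\<^sup>2 / 2 - 3 / 2)))"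
        by (simp add: D_def v_def[symmetric] q_def[symmetric]) (simp add: q)
      then show ?thesis using K v by (simp add: abs_mult)
    qed
    also have "\<dots> \<le> K / 2 / t\<^sup>2 * (hi * 16)"
      using K v * hi_pos assms that by (intro mult_mono divide_left_mono power_mono) auto
    finally show ?thesis by (simp add: M_def)
  qed
  \<comment> \<open>Subtracting the linear part turns the Taylor estimate into a Lipschitz estimate
    for e, whose derivative is at most M * p on the interval.\<close>
  define e where "e r = H r - r * H' t" for r
  have "\<bar>e (t + p) - e t\<bar> \<le> (M * p) * (t + p - t)"
  proof (rule lipschitz_from_bounded_derivative)
    fix r assume r: "r \<in> {t..t + p}"
    then show "(e has_real_derivative H' r - 1 * H' t) (at r)"
      unfolding e_def[abs_def] using assms
      by (intro DERIV_diff H DERIV_cmult_right DERIV_ident) auto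
    have "\<bar>H' r - H' t\<bar> \<le> M * (r - t)"
      by (rule lipschitz_from_bounded_derivative[where f' = D]) (use r assms in \<open>auto intro: H' D\<close>)
    also have "\<dots> \<le> M * p"
      using r K hi_pos by (intro mult_left_mono) (auto simp: M_def)
    finally show "\<bar>H' r - 1 * H' t\<bar> \<le> M * p" by simp
  qed (use assms in auto)
  then have "\<bar>H (t + p) - H t - p * H' t\<bar> \<le> M * p\<^sup>2"
    by (simp add: e_def algebra_simps power2_eq_square)
  moreover have "H' t = curv (z / sqrt t) * (vol (z / sqrt t))\<^sup>2 / (2 * t)"
    using vol_bounds(3)[of "z / sqrt t"] by (simp add: H'_def curv_def w_def flip: K_def)
  moreover have "M = 16 * hi / (hi + lo) / t\<^sup>2" by (simp add: M_def K_def)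
  ultimately show ?thesis by (simp add: H_def w_def)
qed

section \<open>Derivative bounds and the expansion of one step\<close>

lemma slope_bound: "\<bar>slope z\<bar> \<le> 16 / (hi + lo)"
proof -
  define w where "w = z / vol z"
  have "1 * std_normal_density w \<le> (1 + w\<^sup>2)\<^sup>2 * std_normal_density w"
    by (intro mult_right_mono one_le_power) auto
  then have "profile z \<le> 8"
    using std_normal_density_quartic_bound[of w] by (simp add: profile_eq w_def)
  then have "2 / (hi + lo) * profile z \<le> 2 / (hi + lo) * 8"
    using hi_pos lo_pos by (intro mult_left_mono) auto
  then show ?thesis
    using hi_pos lo_pos profile_nonneg[of z] by (simp add: slope_def abs_mult)
qed

lemma curv_bound: "\<bar>curv z\<bar> \<le> 16 / ((hi + lo) * lo)"
proof -
  define v where "v = vol z"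
  define w where "w = z / v"
  have v: "0 < v" "lo \<le> v" using vol_bounds by (auto simp: v_def)
  have "0 \<le> (\<bar>w\<bar> - 1)\<^sup>2" by simp
  then have "\<bar>w\<bar> \<le> 1 + w\<^sup>2" by (simp add: power2_eq_square algebra_simps)
  also have "\<dots> \<le> (1 + w\<^sup>2)\<^sup>2" by (rule self_le_power) auto
  finally have "\<bar>w\<bar> * std_normal_density w \<le> (1 + w\<^sup>2)\<^sup>2 * std_normal_density w"
    by (intro mult_right_mono) auto
  then have w: "\<bar>w\<bar> * std_normal_density w \<le> 8"
    using std_normal_density_quartic_bound[of w] by simp
  have "\<bar>curv z\<bar> = 2 / (hi + lo) / v * (\<bar>w\<bar> * std_normal_density w)"
    using v hi_pos lo_pos
    by (simp add: curv_def profile_eq w_def abs_mult power2_eq_square flip: v_def)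
  also have "\<dots> \<le> 2 / (hi + lo) / lo * 8"
    using v hi_pos lo_pos w by (intro mult_mono divide_left_mono) auto
  finally show ?thesis by simp
qed

text \<open>This is the supremum in the G-heat equation: \<open>curv s\<close> has the sign of s, so
  among the admissible x the product x^2 * \<open>curv s\<close> is largest at hi for s >= 0 and at
  lo for s < 0.\<close>

lemma curv_vol_sign:
  assumes "lo \<le> x" "x \<le> hi"
  shows "curv s * (x\<^sup>2 - (vol s)\<^sup>2) \<le> 0"
proof (cases "0 \<le> s")
  case True
  then have "0 \<le> curv s" "x\<^sup>2 \<le> (vol s)\<^sup>2"
    using assms lo_pos hi_pos profile_nonneg[of s]
    by (auto simp: curv_def vol_def intro!: power_mono)
  then show ?thesis by (simp add: mult_nonneg_nonpos)
next
  case False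
  then have "curv s \<le> 0" "(vol s)\<^sup>2 \<le> x\<^sup>2"
    using assms lo_pos hi_pos profile_nonneg[of s]
    by (auto simp: curv_def vol_def divide_nonpos_nonneg mult_nonpos_nonneg intro!: power_mono)
  then show ?thesis by (simp add: mult_nonpos_nonneg)
qed

lemma borel_measurable_band [measurable]:
  "tail \<in> borel_measurable borel" "slope \<in> borel_measurable borel"
  "curv \<in> borel_measurable borel" "vol \<in> borel_measurable borel"
proof -
  show vol: "vol \<in> borel_measurable borel"
    unfolding vol_def[abs_def] by measurable
  show "curv \<in> borel_measurable borel"
    unfolding curv_def[abs_def] using vol by measurable
  show "slope \<in> borel_measurable borel"
    unfolding slope_def[abs_def] by measurable
  show "tail \<in> borel_measurable borel"
    by (intro borel_measurable_continuous_onI continuous_at_imp_continuous_on)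
       (use tail_has_derivative DERIV_isCont in blast)
qed

text \<open>The space expansion (displacement - y / sqrt t) and the time expansion (from t to t + p)
  share the base point z / sqrt t, so the values there cancel. For y = sigma * epsilon / sqrt n and
  p = 1 / n the term linear in y will have mean zero, and the last term will have the mean drift
  divided by n.\<close>

lemma one_step_expansion:
  assumes "0 < h"
  obtains C where "0 \<le> C"
    and "\<And>t p z y. h \<le> t \<Longrightarrow> 0 < p \<Longrightarrow>
      \<bar>tail ((z - y) / sqrt t) - tail (z / sqrt (t + p))
        - (slope (z / sqrt t) * (- y / sqrt t)
           + curv (z / sqrt t) / (2 * t) * (y\<^sup>2 - p * (vol (z / sqrt t))\<^sup>2))\<bar>
      \<le> C * (\<bar>y\<bar> ^ 3 + p\<^sup>2)"
proof -
  define L where "L = 16 / ((hi + lo) * lo\<^sup>2)"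
  define N where "N = 16 * hi / (hi + lo)"
  have L: "0 \<le> L" "0 \<le> N" using hi_pos lo_pos by (auto simp: L_def N_def)
  show thesis
  proof (rule that[of "L / sqrt h ^ 3 + N / h\<^sup>2"])
    show "0 \<le> L / sqrt h ^ 3 + N / h\<^sup>2" using L assms by simp
  next
    fix t p z y :: real assume t: "h \<le> t" "0 < p"
    have "0 < t" using t assms by simp
    define s where "s = z / sqrt t"
    define d where "d = - y / sqrt t"
    have sd: "(z - y) / sqrt t = s + d" by (simp add: s_def d_def diff_divide_distrib)
    have d2: "d\<^sup>2 = y\<^sup>2 / t" using \<open>0 < t\<close> by (simp add: d_def power_divide)
    have "\<bar>tail (s + d) - tail s - slope s * d - curv s * d\<^sup>2 / 2\<bar> \<le> L * \<bar>d\<bar> ^ 3"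
      by (rule second_order_remainder_bound[OF tail_has_derivative slope_has_derivative])
         (use L curv_lipschitz in \<open>auto simp: L_def\<close>)
    also have "\<dots> = L / sqrt t ^ 3 * \<bar>y\<bar> ^ 3"
      using \<open>0 < t\<close> by (simp add: d_def power_divide)
    also have "\<dots> \<le> L / sqrt h ^ 3 * \<bar>y\<bar> ^ 3"
      using L assms t by (intro mult_right_mono divide_left_mono power_mono) auto
    finally have A: "\<bar>tail (s + d) - tail s - slope s * d - curv s * d\<^sup>2 / 2\<bar> \<le> L / sqrt h ^ 3 * \<bar>y\<bar> ^ 3" .
    have "\<bar>tail (z / sqrt (t + p)) - tail s - p * (curv s * (vol s)\<^sup>2 / (2 * t))\<bar> \<le> N / t\<^sup>2 * p\<^sup>2"
      using time_expansion[OF \<open>0 < t\<close> t(2), of z] by (simp add: s_def N_def)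
    also have "\<dots> \<le> N / h\<^sup>2 * p\<^sup>2"
      using L assms t by (intro mult_right_mono divide_left_mono power_mono) auto
    finally have B: "\<bar>tail (z / sqrt (t + p)) - tail s - p * (curv s * (vol s)\<^sup>2 / (2 * t))\<bar> \<le> N / h\<^sup>2 * p\<^sup>2" .
    have C: "L / sqrt h ^ 3 * \<bar>y\<bar> ^ 3 + N / h\<^sup>2 * p\<^sup>2 \<le> (L / sqrt h ^ 3 + N / h\<^sup>2) * (\<bar>y\<bar> ^ 3 + p\<^sup>2)"
      using L assms by (simp add: algebra_simps)
    have "curv s / (2 * t) * (y\<^sup>2 - p * (vol s)\<^sup>2) = curv s * d\<^sup>2 / 2 - p * (curv s * (vol s)\<^sup>2 / (2 * t))"
      using \<open>0 < t\<close> by (simp add: d2 field_simps)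
    then have "\<bar>tail (s + d) - tail (z / sqrt (t + p))
        - (slope s * d + curv s / (2 * t) * (y\<^sup>2 - p * (vol s)\<^sup>2))\<bar>
        \<le> (L / sqrt h ^ 3 + N / h\<^sup>2) * (\<bar>y\<bar> ^ 3 + p\<^sup>2)"
      using A B C unfolding abs_le_iff by linarith
    then show "\<bar>tail ((z - y) / sqrt t) - tail (z / sqrt (t + p))
        - (slope (z / sqrt t) * (- y / sqrt t)
           + curv (z / sqrt t) / (2 * t) * (y\<^sup>2 - p * (vol (z / sqrt t))\<^sup>2))\<bar>
      \<le> (L / sqrt h ^ 3 + N / h\<^sup>2) * (\<bar>y\<bar> ^ 3 + p\<^sup>2)"
      unfolding sd by (simp add: s_def d_def)
  qed
qed

end

section \<open>Independence of the past and the next noise variable\<close>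

locale standardized_noise = prob_space M
  for M :: "'a measure" +
  fixes \<epsilon> :: "nat \<Rightarrow> 'a \<Rightarrow> real"
  assumes iid: "iid_standardized M \<epsilon>"
begin

abbreviation \<F> :: "nat \<Rightarrow> 'a measure" where
  "\<F> \<equiv> noise_filtration M \<epsilon>"

lemma indep: "indep_vars (\<lambda>_. borel) \<epsilon> {1..}"
  using iid by (simp add: iid_standardized_def)

lemma noise_measurable [measurable]: "1 \<le> i \<Longrightarrow> \<epsilon> i \<in> borel_measurable M"
  using indep by (auto simp: indep_vars_def2)

lemma space_filtration: "space (\<F> k) = space M"
  by (simp add: noise_filtration_def space_measure_of_conv)

lemma sets_filtration:
  "sets (\<F> k) =
     sigma_sets (space M) (\<Union>j\<in>{1..k}. {\<epsilon> j -` A \<inter> space M | A. A \<in> sets borel})"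
  unfolding noise_filtration_def by (rule sets_measure_of) auto

lemma filtration_mono: "i \<le> j \<Longrightarrow> sets (\<F> i) \<subseteq> sets (\<F> j)"
  unfolding sets_filtration by (intro sigma_sets_mono' UN_mono) auto

lemma measurable_filtration_mono:
  "f \<in> measurable (\<F> i) N \<Longrightarrow> i \<le> j \<Longrightarrow> f \<in> measurable (\<F> j) N"
  by (rule measurable_from_subalg[of "\<F> j" "\<F> i"])
     (auto simp: subalgebra_def space_filtration dest: filtration_mono)

lemma filtration_subalgebra: "subalgebra M (\<F> k)"
proof -
  have "(\<Union>j\<in>{1..k}. {\<epsilon> j -` A \<inter> space M | A. A \<in> sets borel}) \<subseteq> sets M"
    using noise_measurable by (auto intro: measurable_sets)
  then show ?thesis
    by (simp add: subalgebra_def space_filtration sets_filtration sets.sigma_sets_subset)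
qed

lemma measurable_filtrationD: "f \<in> measurable (\<F> k) N \<Longrightarrow> f \<in> measurable M N"
  by (rule measurable_from_subalg[OF filtration_subalgebra])

lemma noise_adapted:
  assumes "1 \<le> i" "i \<le> k"
  shows "\<epsilon> i \<in> borel_measurable (\<F> k)"
proof (rule measurableI)
  fix A :: "real set" assume "A \<in> sets borel"
  then show "\<epsilon> i -` A \<inter> space (\<F> k) \<in> sets (\<F> k)"
    unfolding sets_filtration space_filtration using assms
    by (intro sigma_sets.Basic UN_I[of i] CollectI exI[of _ A]) auto
qed simp

text \<open>Independence passes to the sigma-algebras generated by disjoint blocks of indices, here
  {1..k} and {Suc k}, and g depends on the first block only. The case k = 0 is the trivial
  sigma-algebra.\<close>

lemma indep_future_noise:
  assumes g: "g \<in> borel_measurable (\<F> k)"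
  shows "indep_var borel g borel (\<epsilon> (Suc k))"
proof -
  define E where "E = (\<lambda>i. {\<epsilon> i -` A \<inter> space M | A. A \<in> sets borel})"
  define I where "I = case_bool {1..k} {Suc k}"
  have "indep_sets (\<lambda>b. sigma_sets (space M) (\<Union>i\<in>I b. E i)) UNIV"
  proof (rule indep_sets_collect_sigma)
    have "(\<Union>b. I b) \<subseteq> {1..}" by (auto simp: I_def split: bool.splits)
    then show "indep_sets E (\<Union>b. I b)"
      using indep unfolding indep_vars_def2 E_def by (auto intro: indep_sets_mono_index)
    show "Int_stable (E i)" for i
    proof (rule Int_stableI)
      fix a b assume "a \<in> E i" "b \<in> E i"
      then obtain A B where "a = \<epsilon> i -` A \<inter> space M" "b = \<epsilon> i -` B \<inter> space M"
        "A \<in> sets borel" "B \<in> sets borel" by (auto simp: E_def)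
      then show "a \<inter> b \<in> E i"
        unfolding E_def by (intro CollectI exI[of _ "A \<inter> B"]) auto
    qed
    show "disjoint_family_on I UNIV"
      by (auto simp: disjoint_family_on_def I_def split: bool.splits)
  qed
  then have S: "indep_set (sigma_sets (space M) (\<Union>i\<in>{1..k}. E i)) (sigma_sets (space M) (E (Suc k)))"
    unfolding indep_set_def
    by (rule iffD1[OF indep_sets_cong, rotated 2]) (auto simp: I_def split: bool.splits)
  have "sigma_sets (space M) {g -` A \<inter> space M | A. A \<in> sets borel}
      \<subseteq> sigma_sets (space M) (\<Union>i\<in>{1..k}. E i)"
  proof (rule sigma_sets_mono)
    show "{g -` A \<inter> space M | A. A \<in> sets borel} \<subseteq> sigma_sets (space M) (\<Union>i\<in>{1..k}. E i)"
      using measurable_sets[OF g] by (auto simp: space_filtration sets_filtration E_def)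
  qed
  then have "indep_set (sigma_sets (space M) {g -` A \<inter> space M | A. A \<in> sets borel})
      (sigma_sets (space M) (E (Suc k)))"
    using S unfolding indep_set_def
    by (elim indep_sets_mono_sets) (auto split: bool.splits)
  then show ?thesis
    using measurable_filtrationD[OF g] unfolding indep_var_eq E_def by auto
qed

text \<open>Takes the place of conditioning on the past: in the expansion of a step, each power of
  the new noise comes with a bounded coefficient known before the step.\<close>

lemma integral_mult_future_noise:
  fixes f :: "real \<Rightarrow> real"
  assumes g: "g \<in> borel_measurable (\<F> k)"
    and bound: "\<And>\<omega>. \<omega> \<in> space M \<Longrightarrow> \<bar>g \<omega>\<bar> \<le> b"
    and f: "f \<in> borel_measurable borel" and int: "integrable M (\<lambda>\<omega>. f (\<epsilon> (Suc k) \<omega>))"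
  shows "integrable M (\<lambda>\<omega>. g \<omega> * f (\<epsilon> (Suc k) \<omega>))"
    and "expectation (\<lambda>\<omega>. g \<omega> * f (\<epsilon> (Suc k) \<omega>)) = expectation g * expectation (\<lambda>\<omega>. f (\<epsilon> (Suc k) \<omega>))"
proof -
  have iv: "indep_var borel g borel (\<lambda>\<omega>. f (\<epsilon> (Suc k) \<omega>))"
    using indep_var_compose[OF indep_future_noise[OF g], of "\<lambda>x. x" borel f borel] f
    by (simp add: comp_def)
  have gi: "integrable M g"
    using measurable_filtrationD[OF g] bound by (intro integrable_const_bound[where B = b]) auto
  show "integrable M (\<lambda>\<omega>. g \<omega> * f (\<epsilon> (Suc k) \<omega>))"
    by (rule indep_var_integrable[OF iv gi int])
  show "expectation (\<lambda>\<omega>. g \<omega> * f (\<epsilon> (Suc k) \<omega>)) = expectation g * expectation (\<lambda>\<omega>. f (\<epsilon> (Suc k) \<omega>))"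
    by (rule indep_var_lebesgue_integral[OF iv gi int])
qed

lemma noise_moments:
  assumes "1 \<le> i"
  shows "integrable M (\<lambda>\<omega>. \<bar>\<epsilon> i \<omega>\<bar> ^ 3)" "integrable M (\<lambda>\<omega>. (\<epsilon> i \<omega>)\<^sup>2)" "integrable M (\<epsilon> i)"
    and "expectation (\<epsilon> i) = 0" "expectation (\<lambda>\<omega>. (\<epsilon> i \<omega>)\<^sup>2) = 1"
    and "expectation (\<lambda>\<omega>. \<bar>\<epsilon> i \<omega>\<bar> ^ 3) = expectation (\<lambda>\<omega>. \<bar>\<epsilon> 1 \<omega>\<bar> ^ 3)"
proof -
  show "integrable M (\<lambda>\<omega>. \<bar>\<epsilon> i \<omega>\<bar> ^ 3)" "expectation (\<epsilon> i) = 0"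
    and e2: "expectation (\<lambda>\<omega>. (\<epsilon> i \<omega>)\<^sup>2) = 1"
    using iid assms unfolding iid_standardized_def by blast+
  \<comment> \<open>A Bochner integral that does not exist has the value 0, so the value 1 already
    proves integrability.\<close>
  show i2: "integrable M (\<lambda>\<omega>. (\<epsilon> i \<omega>)\<^sup>2)"
    using e2 not_integrable_integral_eq[of M "\<lambda>\<omega>. (\<epsilon> i \<omega>)\<^sup>2"] by (metis zero_neq_one)
  show "integrable M (\<epsilon> i)"
    by (rule square_integrable_imp_integrable[OF noise_measurable[OF assms] i2])
  \<comment> \<open>Identical distribution makes the third moment, and with it the constant of the
    one-step estimate, independent of i.\<close>
  have "expectation (\<lambda>\<omega>. \<bar>\<epsilon> j \<omega>\<bar> ^ 3) = (\<integral>x. \<bar>x\<bar> ^ 3 \<partial>distr M borel (\<epsilon> j))" if "1 \<le> j" for j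
    using that by (subst integral_distr) auto
  moreover have "distr M borel (\<epsilon> i) = distr M borel (\<epsilon> 1)"
    using iid assms unfolding iid_standardized_def by blast
  ultimately show "expectation (\<lambda>\<omega>. \<bar>\<epsilon> i \<omega>\<bar> ^ 3) = expectation (\<lambda>\<omega>. \<bar>\<epsilon> 1 \<omega>\<bar> ^ 3)"
    using assms by simp
qed

end

section \<open>Lindeberg telescoping\<close>

locale controlled_walk = standardized_noise M \<epsilon> + volatility_band lo hi
  for M :: "'a measure" and \<epsilon> :: "nat \<Rightarrow> 'a \<Rightarrow> real" and lo hi :: real
begin

abbreviation controls :: "(nat \<Rightarrow> 'a \<Rightarrow> real) set" where
  "controls \<equiv> predictable_controls M \<epsilon> lo hi"

text \<open>The scale n stays fixed while k counts the steps, so that k = 0, ..., n traces one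
  path.\<close>

definition walk :: "nat \<Rightarrow> (nat \<Rightarrow> 'a \<Rightarrow> real) \<Rightarrow> nat \<Rightarrow> 'a \<Rightarrow> real" where
  "walk n \<sigma> k \<omega> = (\<Sum>i=1..k. \<sigma> i \<omega> * \<epsilon> i \<omega>) / sqrt (real n)"

lemma walk_0: "walk n \<sigma> 0 \<omega> = 0"
  by (simp add: walk_def)

lemma walk_Suc: "walk n \<sigma> (Suc k) \<omega> = walk n \<sigma> k \<omega> + \<sigma> (Suc k) \<omega> * \<epsilon> (Suc k) \<omega> / sqrt (real n)"
  by (simp add: walk_def add_divide_distrib)

lemma controls_measurable:
  assumes "\<sigma> \<in> controls"
  shows "\<sigma> (Suc k) \<in> borel_measurable (\<F> k)"
  using assms by (auto simp: predictable_controls_def dest: spec[of _ "Suc k"])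

lemma controls_bounds:
  assumes "\<sigma> \<in> controls" "\<omega> \<in> space M"
  shows "lo \<le> \<sigma> (Suc k) \<omega>" "\<sigma> (Suc k) \<omega> \<le> hi"
  using assms by (auto simp: predictable_controls_def)

lemma walk_adapted:
  assumes "\<sigma> \<in> controls"
  shows "walk n \<sigma> k \<in> borel_measurable (\<F> k)"
proof (induction k)
  case 0
  show ?case by (simp add: walk_0)
next
  case (Suc k)
  have [measurable]: "walk n \<sigma> k \<in> borel_measurable (\<F> (Suc k))"
    "\<sigma> (Suc k) \<in> borel_measurable (\<F> (Suc k))"
    "\<epsilon> (Suc k) \<in> borel_measurable (\<F> (Suc k))"
    using measurable_filtration_mono[OF Suc] noise_adapted[of "Suc k" "Suc k"]
      measurable_filtration_mono[OF controls_measurable[OF assms]] by auto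
  show ?case unfolding walk_Suc[abs_def] by measurable
qed

text \<open>Solution at time \<open>t > 0\<close> of the \<open>G\<close>-heat equation with initial value the indicator of
  \<open>(c, \<infinity>)\<close>.\<close>

definition heat :: "real \<Rightarrow> real \<Rightarrow> real \<Rightarrow> real" where
  "heat c t x = tail ((c - x) / sqrt t)"

text \<open>With \<open>u\<close> the function \<open>heat c\<close>, this is \<open>\<sigma>\<^sup>2 u\<^sub>x\<^sub>x / 2 - u\<^sub>t\<close> at the walk:
  the maximising volatility turns \<open>u\<^sub>t\<close> into \<open>vol\<^sup>2 u\<^sub>x\<^sub>x / 2\<close>.\<close>

definition drift :: "real \<Rightarrow> real \<Rightarrow> nat \<Rightarrow> (nat \<Rightarrow> 'a \<Rightarrow> real) \<Rightarrow> nat \<Rightarrow> 'a \<Rightarrow> real" where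
  "drift c t n \<sigma> k \<omega> = curv ((c - walk n \<sigma> k \<omega>) / sqrt t) / (2 * t)
     * ((\<sigma> (Suc k) \<omega>)\<^sup>2 - (vol ((c - walk n \<sigma> k \<omega>) / sqrt t))\<^sup>2)"

lemma heat_bounds: "0 \<le> heat c t x" "heat c t x \<le> 1"
  by (simp_all add: heat_def tail_bounds)

lemma heat_walk_integrable:
  assumes "\<sigma> \<in> controls"
  shows "integrable M (\<lambda>\<omega>. heat c t (walk n \<sigma> k \<omega>))"
proof (rule integrable_const_bound[where B = 1])
  have [measurable]: "walk n \<sigma> k \<in> borel_measurable M"
    using walk_adapted[OF assms] by (rule measurable_filtrationD)
  show "(\<lambda>\<omega>. heat c t (walk n \<sigma> k \<omega>)) \<in> borel_measurable M"
    unfolding heat_def by measurable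
qed (use heat_bounds in auto)

text \<open>B is chosen before n, t, c, k and the control. This uniformity allows both summing over
  n steps and taking the supremum over controls.\<close>

lemma one_step_expectation:
  assumes "0 < h"
  obtains B where "0 \<le> B"
    and "\<And>n t c k \<sigma>. 0 < n \<Longrightarrow> h \<le> t \<Longrightarrow> \<sigma> \<in> controls \<Longrightarrow>
      \<bar>expectation (\<lambda>\<omega>. heat c t (walk n \<sigma> (Suc k) \<omega>))
        - expectation (\<lambda>\<omega>. heat c (t + 1 / real n) (walk n \<sigma> k \<omega>))
        - expectation (drift c t n \<sigma> k) / real n\<bar> \<le> B / (real n * sqrt (real n))"
proof -
  obtain C where C: "0 \<le> C" and
    step: "\<And>t p z y. h \<le> t \<Longrightarrow> 0 < p \<Longrightarrow>
      \<bar>tail ((z - y) / sqrt t) - tail (z / sqrt (t + p))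
        - (slope (z / sqrt t) * (- y / sqrt t)
           + curv (z / sqrt t) / (2 * t) * (y\<^sup>2 - p * (vol (z / sqrt t))\<^sup>2))\<bar>
      \<le> C * (\<bar>y\<bar> ^ 3 + p\<^sup>2)"
    using one_step_expansion[OF assms] by blast
  define m3 where "m3 = expectation (\<lambda>\<omega>. \<bar>\<epsilon> 1 \<omega>\<bar> ^ 3)"
  have m3: "0 \<le> m3" by (simp add: m3_def)
  show thesis
  proof (rule that[of "C * (hi ^ 3 * m3 + 1)"])
    show "0 \<le> C * (hi ^ 3 * m3 + 1)" using C m3 hi_pos by simp
  next
    fix n k :: nat and t c :: real and \<sigma>
    assume n: "0 < n" and t: "h \<le> t" and \<sigma>: "\<sigma> \<in> controls"
    define r where "r = sqrt (real n)"
    have r: "1 \<le> r" "real n = r\<^sup>2" using n by (simp_all add: r_def)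
    define s where "s \<omega> = (c - walk n \<sigma> k \<omega>) / sqrt t" for \<omega>
    define a where "a \<omega> = heat c t (walk n \<sigma> (Suc k) \<omega>)" for \<omega>
    define b where "b \<omega> = heat c (t + 1 / real n) (walk n \<sigma> k \<omega>)" for \<omega>
    \<comment> \<open>The coefficients of the next noise variable, of its square, and the term
      without it (up to sign), in \<open>one_step_expansion\<close> with p = 1 / r^2. All three are
      known before the step.\<close>
    define g1 where "g1 \<omega> = slope (s \<omega>) * (- \<sigma> (Suc k) \<omega> / (r * sqrt t))" for \<omega>
    define g2 where "g2 \<omega> = curv (s \<omega>) / (2 * t) * (\<sigma> (Suc k) \<omega>)\<^sup>2 / r\<^sup>2" for \<omega>
    define g3 where "g3 \<omega> = curv (s \<omega>) / (2 * t) * (vol (s \<omega>))\<^sup>2 / r\<^sup>2" for \<omega>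
    have t0: "0 < t" using t assms by simp
    have [measurable]: "walk n \<sigma> k \<in> borel_measurable (\<F> k)"
      "\<sigma> (Suc k) \<in> borel_measurable (\<F> k)"
      using walk_adapted[OF \<sigma>] controls_measurable[OF \<sigma>] by auto
    have s [measurable]: "s \<in> borel_measurable (\<F> k)"
      unfolding s_def[abs_def] by measurable
    have g: "g1 \<in> borel_measurable (\<F> k)" "g2 \<in> borel_measurable (\<F> k)"
      "g3 \<in> borel_measurable (\<F> k)"
      unfolding g1_def[abs_def] g2_def[abs_def] g3_def[abs_def] by measurable
    have bd: "\<bar>\<sigma> (Suc k) \<omega>\<bar> \<le> hi" if "\<omega> \<in> space M" for \<omega>
      using controls_bounds[OF \<sigma> that, of k] lo_pos by auto
    have g1b: "\<bar>g1 \<omega>\<bar> \<le> 16 / (hi + lo) * (hi / (r * sqrt t))" if "\<omega> \<in> space M" for \<omega>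
      unfolding g1_def abs_mult using slope_bound[of "s \<omega>"] bd[OF that] r(1) t0 hi_pos lo_pos
      by (intro mult_mono) (auto simp: abs_mult intro!: divide_right_mono)
    have g2b: "\<bar>g2 \<omega>\<bar> \<le> 16 / ((hi + lo) * lo) / (2 * t) * hi\<^sup>2 / r\<^sup>2" if "\<omega> \<in> space M" for \<omega>
      unfolding g2_def abs_mult abs_divide
      using r(1) curv_bound[of "s \<omega>"] bd[OF that] t0 hi_pos lo_pos
      by (intro mult_mono divide_right_mono frac_le) (auto intro!: abs_le_square_iff[THEN iffD1])
    have g3b: "\<bar>g3 \<omega>\<bar> \<le> 16 / ((hi + lo) * lo) / (2 * t) * hi\<^sup>2 / r\<^sup>2" for \<omega>
      unfolding g3_def abs_mult abs_divide
      using r(1) curv_bound[of "s \<omega>"] vol_bounds[of "s \<omega>"] t0 hi_pos lo_pos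
      by (intro mult_mono divide_right_mono frac_le) (auto intro!: power_mono)
    note mom = noise_moments[of "Suc k", simplified]
    have e1: "integrable M (\<lambda>\<omega>. g1 \<omega> * \<epsilon> (Suc k) \<omega>)"
      "expectation (\<lambda>\<omega>. g1 \<omega> * \<epsilon> (Suc k) \<omega>) = 0"
      using integral_mult_future_noise[OF g(1) g1b, of "\<lambda>x. x"] mom by simp_all
    have e2: "integrable M (\<lambda>\<omega>. g2 \<omega> * (\<epsilon> (Suc k) \<omega>)\<^sup>2)"
      "expectation (\<lambda>\<omega>. g2 \<omega> * (\<epsilon> (Suc k) \<omega>)\<^sup>2) = expectation g2"
      using integral_mult_future_noise[OF g(2) g2b, of "\<lambda>x. x\<^sup>2"] mom by simp_all
    have i2: "integrable M g2"
      using measurable_filtrationD[OF g(2)] g2b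
      by (intro integrable_const_bound[where B = "16 / ((hi + lo) * lo) / (2 * t) * hi\<^sup>2 / r\<^sup>2"]) auto
    have i3: "integrable M g3"
      using measurable_filtrationD[OF g(3)] g3b
      by (intro integrable_const_bound[where B = "16 / ((hi + lo) * lo) / (2 * t) * hi\<^sup>2 / r\<^sup>2"]) auto
    have ia: "integrable M a" and ib: "integrable M b"
      unfolding a_def[abs_def] b_def[abs_def] by (rule heat_walk_integrable[OF \<sigma>])+
    have drift: "expectation (drift c t n \<sigma> k) / real n = expectation g2 - expectation g3"
    proof -
      have "expectation g2 - expectation g3 = expectation (\<lambda>\<omega>. g2 \<omega> - g3 \<omega>)"
        using i2 i3 by simp
      also have "(\<lambda>\<omega>. g2 \<omega> - g3 \<omega>) = (\<lambda>\<omega>. drift c t n \<sigma> k \<omega> / real n)"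
        by (simp add: fun_eq_iff g2_def g3_def drift_def s_def r algebra_simps diff_divide_distrib)
      finally show ?thesis by simp
    qed
    have point: "\<bar>a \<omega> - b \<omega> - (g1 \<omega> * \<epsilon> (Suc k) \<omega> + g2 \<omega> * (\<epsilon> (Suc k) \<omega>)\<^sup>2 - g3 \<omega>)\<bar>
        \<le> C / r ^ 3 * (hi ^ 3 * \<bar>\<epsilon> (Suc k) \<omega>\<bar> ^ 3 + 1)" if "\<omega> \<in> space M" for \<omega>
    proof -
      define e where "e = \<epsilon> (Suc k) \<omega>"
      define x where "x = \<sigma> (Suc k) \<omega>"
      define z where "z = c - walk n \<sigma> k \<omega>"
      define y where "y = x * e / r"
      have "a \<omega> = tail ((z - y) / sqrt t)"
        by (simp add: a_def heat_def walk_Suc z_def y_def x_def e_def r_def algebra_simps)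
      moreover have "b \<omega> = tail (z / sqrt (t + 1 / r\<^sup>2))"
        by (simp add: b_def heat_def z_def r)
      moreover have "g1 \<omega> * e = slope (z / sqrt t) * (- y / sqrt t)"
        by (simp add: g1_def s_def y_def z_def x_def)
      moreover have "g2 \<omega> * e\<^sup>2 - g3 \<omega>
          = curv (z / sqrt t) / (2 * t) * (y\<^sup>2 - 1 / r\<^sup>2 * (vol (z / sqrt t))\<^sup>2)"
        by (simp add: g2_def g3_def s_def z_def[symmetric] y_def x_def[symmetric]
            power_divide power_mult_distrib right_diff_distrib)
      ultimately have "\<bar>a \<omega> - b \<omega> - (g1 \<omega> * e + g2 \<omega> * e\<^sup>2 - g3 \<omega>)\<bar>
          \<le> C * (\<bar>y\<bar> ^ 3 + (1 / r\<^sup>2)\<^sup>2)"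
        using step[OF t, of "1 / r\<^sup>2" z y] r(1) by (simp add: add_diff_eq)
      also have "\<dots> \<le> C * ((hi ^ 3 * \<bar>e\<bar> ^ 3) / r ^ 3 + 1 / r ^ 3)"
      proof (intro mult_left_mono add_mono C)
        have "\<bar>y\<bar> ^ 3 = (\<bar>x\<bar> ^ 3 * \<bar>e\<bar> ^ 3) / r ^ 3"
          using r(1) by (simp add: y_def abs_mult power_divide power_mult_distrib)
        also have "\<dots> \<le> (hi ^ 3 * \<bar>e\<bar> ^ 3) / r ^ 3"
          using r(1) bd[OF that] by (intro divide_right_mono mult_right_mono power_mono) (auto simp: x_def)
        finally show "\<bar>y\<bar> ^ 3 \<le> (hi ^ 3 * \<bar>e\<bar> ^ 3) / r ^ 3" .
        \<comment> \<open>The time error is of order n^(-2); since r >= 1, it is absorbed into the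
          order n^(-3/2) of the space error.\<close>
        have "r ^ 3 \<le> r ^ 4" using r(1) by (intro power_increasing) auto
        then show "(1 / r\<^sup>2)\<^sup>2 \<le> 1 / r ^ 3"
          using r(1) by (simp add: power_divide power_mult[symmetric] field_simps)
      qed
      also have "\<dots> = C / r ^ 3 * (hi ^ 3 * \<bar>e\<bar> ^ 3 + 1)"
        by (simp add: add_divide_distrib distrib_left)
      finally show ?thesis by (simp add: e_def)
    qed
    define D where "D \<omega> = a \<omega> - b \<omega> - (g1 \<omega> * \<epsilon> (Suc k) \<omega> + g2 \<omega> * (\<epsilon> (Suc k) \<omega>)\<^sup>2 - g3 \<omega>)" for \<omega>
    have iD: "integrable M D"
      unfolding D_def[abs_def]
      by (intro Bochner_Integration.integrable_diff Bochner_Integration.integrable_add ia ib e1 e2 i3)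
    have ED: "expectation D = expectation a - expectation b - (expectation g2 - expectation g3)"
      unfolding D_def[abs_def] using ia ib e1 e2 i3 by simp
    have "\<bar>expectation D\<bar> \<le> expectation (\<lambda>\<omega>. \<bar>D \<omega>\<bar>)"
      by (rule integral_abs_bound)
    also have "\<dots> \<le> expectation (\<lambda>\<omega>. C / r ^ 3 * (hi ^ 3 * \<bar>\<epsilon> (Suc k) \<omega>\<bar> ^ 3 + 1))"
    proof (rule integral_mono)
      show "integrable M (\<lambda>\<omega>. C / r ^ 3 * (hi ^ 3 * \<bar>\<epsilon> (Suc k) \<omega>\<bar> ^ 3 + 1))"
        by (intro integrable_mult_right Bochner_Integration.integrable_add mom(1)) auto
      show "integrable M (\<lambda>\<omega>. \<bar>D \<omega>\<bar>)" by (rule integrable_abs[OF iD])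
    qed (use point in \<open>simp add: D_def\<close>)
    also have "\<dots> = C / r ^ 3 * (hi ^ 3 * m3 + 1)"
      using mom(1) mom(6) by (simp add: m3_def prob_space)
    finally have "\<bar>expectation a - expectation b - (expectation g2 - expectation g3)\<bar>
        \<le> C / r ^ 3 * (hi ^ 3 * m3 + 1)"
      unfolding ED .
    moreover have "r ^ 3 = real n * sqrt (real n)"
    proof -
      have "r ^ 3 = r\<^sup>2 * r" by (simp add: power2_eq_square power3_eq_cube)
      then have "r ^ 3 = real n * r" by (simp only: r(2)[symmetric])
      then show ?thesis by (simp only: r_def)
    qed
    ultimately show "\<bar>expectation (\<lambda>\<omega>. heat c t (walk n \<sigma> (Suc k) \<omega>))
        - expectation (\<lambda>\<omega>. heat c (t + 1 / real n) (walk n \<sigma> k \<omega>))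
        - expectation (drift c t n \<sigma> k) / real n\<bar> \<le> C * (hi ^ 3 * m3 + 1) / (real n * sqrt (real n))"
      unfolding drift by (simp add: a_def[abs_def] b_def[abs_def])
  qed
qed

lemma expectation_drift_nonpos:
  assumes "\<sigma> \<in> controls" "0 < t"
  shows "expectation (drift c t n \<sigma> k) \<le> 0"
proof -
  have "drift c t n \<sigma> k \<omega> \<le> 0" if "\<omega> \<in> space M" for \<omega>
    using curv_vol_sign[OF controls_bounds[OF assms(1) that]] assms(2)
    by (simp add: drift_def divide_nonpos_pos)
  \<comment> \<open>Nonnegativity of an integral asks for no integrability, hence the change of
    sign.\<close>
  then have "0 \<le> expectation (\<lambda>\<omega>. - drift c t n \<sigma> k \<omega>)"
    by (intro Bochner_Integration.integral_nonneg) auto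
  then show ?thesis by simp
qed

section \<open>The optimal feedback control and the telescoping sum\<close>

primrec feedback_sum :: "nat \<Rightarrow> real \<Rightarrow> 'a \<Rightarrow> nat \<Rightarrow> real" where
  "feedback_sum n c \<omega> 0 = 0"
| "feedback_sum n c \<omega> (Suc k) =
     feedback_sum n c \<omega> k + vol (c - feedback_sum n c \<omega> k / sqrt (real n)) * \<epsilon> (Suc k) \<omega>"

text \<open>Control and walk determine each other, so the path is built first by recursion and the
  control is read off from it. Step i looks at the sum up to i - 1, which makes the control
  predictable.\<close>

definition feedback :: "nat \<Rightarrow> real \<Rightarrow> nat \<Rightarrow> 'a \<Rightarrow> real" where
  "feedback n c i \<omega> = vol (c - feedback_sum n c \<omega> (i - 1) / sqrt (real n))"

lemma feedback_sum_adapted: "(\<lambda>\<omega>. feedback_sum n c \<omega> k) \<in> borel_measurable (\<F> k)"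
proof (induction k)
  case (Suc k)
  have [measurable]: "(\<lambda>\<omega>. feedback_sum n c \<omega> k) \<in> borel_measurable (\<F> (Suc k))"
    "\<epsilon> (Suc k) \<in> borel_measurable (\<F> (Suc k))"
    using measurable_filtration_mono[OF Suc] noise_adapted[of "Suc k" "Suc k"] by auto
  show ?case by simp
qed simp

lemma feedback_controls: "feedback n c \<in> controls"
proof -
  have "feedback n c i \<in> borel_measurable (\<F> (i - 1))" for i
    unfolding feedback_def[abs_def] using feedback_sum_adapted[of n c "i - 1"] by measurable
  then show ?thesis
    using vol_bounds by (simp add: predictable_controls_def feedback_def)
qed

lemma feedback_Suc: "feedback n c (Suc k) \<omega> = vol (c - walk n (feedback n c) k \<omega>)"
proof -
  have "(\<Sum>i=1..k. feedback n c i \<omega> * \<epsilon> i \<omega>) = feedback_sum n c \<omega> k"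
    by (induction k) (simp_all add: feedback_def)
  then show ?thesis by (simp add: feedback_def walk_def)
qed

text \<open>\<open>vol\<close> depends only on the sign of its argument, so dividing by sqrt t
  changes nothing: one feedback rule is optimal for every remaining time.\<close>

lemma drift_feedback:
  assumes "0 < t"
  shows "drift c t n (feedback n c) k \<omega> = 0"
proof -
  have "vol (z / sqrt t) = vol z" for z
    using assms by (simp add: vol_def zero_le_divide_iff)
  then show ?thesis by (simp add: drift_def feedback_Suc)
qed

text \<open>The walk starts at 0, so the initial value of the telescoping sum is the same for all
  controls. Nonpositive drift gives the upper bound for every control, zero drift the matching lower
  bound for the feedback.\<close>

lemma heat_expectation_estimates:
  assumes "0 < h"
  obtains B where "0 \<le> B"
    and "\<And>n c \<sigma>. 0 < n \<Longrightarrow> \<sigma> \<in> controls \<Longrightarrow>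
      expectation (\<lambda>\<omega>. heat c h (walk n \<sigma> n \<omega>)) \<le> tail (c / sqrt (1 + h)) + B / sqrt (real n)"
    and "\<And>n c. 0 < n \<Longrightarrow>
      expectation (\<lambda>\<omega>. heat c h (walk n (feedback n c) n \<omega>)) \<ge> tail (c / sqrt (1 + h)) - B / sqrt (real n)"
proof -
  obtain B where B: "0 \<le> B" and
    step: "\<And>n t c k \<sigma>. 0 < n \<Longrightarrow> h \<le> t \<Longrightarrow> \<sigma> \<in> controls \<Longrightarrow>
      \<bar>expectation (\<lambda>\<omega>. heat c t (walk n \<sigma> (Suc k) \<omega>))
        - expectation (\<lambda>\<omega>. heat c (t + 1 / real n) (walk n \<sigma> k \<omega>))
        - expectation (drift c t n \<sigma> k) / real n\<bar> \<le> B / (real n * sqrt (real n))"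
    using one_step_expectation[OF assms] by blast
  \<comment> \<open>The time left after k of n steps, plus h: it falls from 1 + h to h in steps of 1
    / n, so the one-step estimate is only used at times t >= h.\<close>
  define T where "T n k = h + (real n - real k) / real n" for n k :: nat
  define V where "V n c \<sigma> k = expectation (\<lambda>\<omega>. heat c (T n k) (walk n \<sigma> k \<omega>))" for n c \<sigma> k
  have T: "T n k = T n (Suc k) + 1 / real n" if "0 < n" for n k
    using that by (simp add: T_def field_simps)
  have Th: "h \<le> T n (Suc k)" if "k < n" for n k
    using that by (simp add: T_def)
  have start: "V n c \<sigma> 0 = tail (c / sqrt (1 + h))" if "0 < n" for n c \<sigma>
    using that by (simp add: V_def T_def walk_0 heat_def prob_space add.commute)
  have finish: "V n c \<sigma> n = expectation (\<lambda>\<omega>. heat c h (walk n \<sigma> n \<omega>))" for n c \<sigma>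
    by (simp add: V_def T_def)
  define \<delta> where "\<delta> n = B / (real n * sqrt (real n))" for n :: nat
  have one: "\<bar>V n c \<sigma> (Suc k) - V n c \<sigma> k - expectation (drift c (T n (Suc k)) n \<sigma> k) / real n\<bar>
      \<le> \<delta> n" if "k < n" "\<sigma> \<in> controls" for n c \<sigma> k
    using step[of n "T n (Suc k)" \<sigma> c k] that Th[OF that(1)] T[of n k] by (simp add: V_def \<delta>_def)
  have total: "real n * \<delta> n = B / sqrt (real n)" if "0 < n" for n :: nat
    using that by (simp add: \<delta>_def)
  show thesis
  proof (rule that[OF B])
    fix n :: nat and c and \<sigma> assume n: "0 < n" and \<sigma>: "\<sigma> \<in> controls"
    have "V n c \<sigma> k \<le> V n c \<sigma> 0 + real k * \<delta> n" if "k \<le> n" for k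
      using that
    proof (induction k)
      case (Suc k)
      have "expectation (drift c (T n (Suc k)) n \<sigma> k) / real n \<le> 0"
        using expectation_drift_nonpos[OF \<sigma>, of "T n (Suc k)"] Th[of k n] Suc.prems assms
        by (simp add: divide_nonpos_nonneg)
      then have "V n c \<sigma> (Suc k) \<le> V n c \<sigma> k + \<delta> n"
        using one[of k n \<sigma> c] Suc.prems \<sigma> by (simp add: abs_le_iff)
      then show ?case using Suc by (simp add: distrib_right)
    qed simp
    from this[of n] show "expectation (\<lambda>\<omega>. heat c h (walk n \<sigma> n \<omega>)) \<le> tail (c / sqrt (1 + h)) + B / sqrt (real n)"
      using start[OF n] finish total[OF n] by simp
  next
    fix n :: nat and c assume n: "0 < n"
    define \<sigma> where "\<sigma> = feedback n c"
    have \<sigma>: "\<sigma> \<in> controls" by (simp add: \<sigma>_def feedback_controls)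
    have "V n c \<sigma> k \<ge> V n c \<sigma> 0 - real k * \<delta> n" if "k \<le> n" for k
      using that
    proof (induction k)
      case (Suc k)
      have "0 < T n (Suc k)" using Th[of k n] Suc.prems assms by simp
      then have "drift c (T n (Suc k)) n \<sigma> k = (\<lambda>_. 0)"
        by (simp add: drift_feedback \<sigma>_def fun_eq_iff)
      then have "expectation (drift c (T n (Suc k)) n \<sigma> k) = 0" by simp
      then have "V n c \<sigma> (Suc k) \<ge> V n c \<sigma> k - \<delta> n"
        using one[of k n \<sigma> c] Suc.prems \<sigma> by (simp add: abs_le_iff)
      then show ?case using Suc by (simp add: distrib_right)
    qed simp
    from this[of n] show "expectation (\<lambda>\<omega>. heat c h (walk n (feedback n c) n \<omega>)) \<ge> tail (c / sqrt (1 + h)) - B / sqrt (real n)"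
      using start[OF n] finish total[OF n] by (simp add: \<sigma>_def)
  qed
qed

section \<open>From the smoothed indicator to tail probabilities\<close>

lemma prob_walk_bounds:
  assumes \<sigma>: "\<sigma> \<in> controls" and "0 < h" and lower: "1 - \<eta> \<le> tail (- a / sqrt h)"
    and upper: "tail (a / sqrt h) \<le> \<eta>"
  shows "prob {\<omega> \<in> space M. c < walk n \<sigma> k \<omega>} \<le> expectation (\<lambda>\<omega>. heat (c - a) h (walk n \<sigma> k \<omega>)) + \<eta>"
    and "expectation (\<lambda>\<omega>. heat (c + a) h (walk n \<sigma> k \<omega>)) - \<eta> \<le> prob {\<omega> \<in> space M. c < walk n \<sigma> k \<omega>}"
proof -
  define A where "A = {\<omega> \<in> space M. c < walk n \<sigma> k \<omega>}"
  have [measurable]: "walk n \<sigma> k \<in> borel_measurable M"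
    using walk_adapted[OF \<sigma>] by (rule measurable_filtrationD)
  have A [measurable]: "A \<in> events" unfolding A_def by measurable
  have pA: "prob A = expectation (\<lambda>\<omega>. indicator A \<omega>)" using A by simp
  have iA: "integrable M (indicator A :: 'a \<Rightarrow> real)" by (intro integrable_real_indicator A) (simp add: less_top[symmetric])
  have \<eta>: "0 \<le> \<eta>" using tail_bounds(1)[of "a / sqrt h"] upper by simp
  note heat_int = heat_walk_integrable[OF \<sigma>]
  have "expectation (\<lambda>\<omega>. indicator A \<omega>) \<le> expectation (\<lambda>\<omega>. heat (c - a) h (walk n \<sigma> k \<omega>) + \<eta>)"
  proof (rule integral_mono)
    fix \<omega> assume "\<omega> \<in> space M"
    show "indicator A \<omega> \<le> heat (c - a) h (walk n \<sigma> k \<omega>) + \<eta>"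
    \<comment> \<open>On A the walk lies beyond c, at distance more than a from the shifted level c
      - a; there the smoothed indicator is at least 1 - \<open>\<eta>\<close>. Off A nonnegativity
      suffices.\<close>
    proof (cases "\<omega> \<in> A")
      case True
      then have "(c - a - walk n \<sigma> k \<omega>) / sqrt h \<le> - a / sqrt h"
        using \<open>0 < h\<close> by (intro divide_right_mono) (auto simp: A_def)
      then have "tail (- a / sqrt h) \<le> heat (c - a) h (walk n \<sigma> k \<omega>)"
        unfolding heat_def by (rule tail_antimono)
      then show ?thesis using lower True by simp
    next
      case False
      then show ?thesis
        using add_nonneg_nonneg[OF heat_bounds(1)[of "c - a" h "walk n \<sigma> k \<omega>"] \<eta>] by simp
    qed
  qed (intro Bochner_Integration.integrable_add iA heat_int integrable_const)+
  then show "prob {\<omega> \<in> space M. c < walk n \<sigma> k \<omega>} \<le> expectation (\<lambda>\<omega>. heat (c - a) h (walk n \<sigma> k \<omega>)) + \<eta>"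
    using heat_int unfolding A_def[symmetric] pA by (simp add: prob_space)
  have "expectation (\<lambda>\<omega>. heat (c + a) h (walk n \<sigma> k \<omega>) - \<eta>) \<le> expectation (\<lambda>\<omega>. indicator A \<omega>)"
  proof (rule integral_mono)
    fix \<omega> assume "\<omega> \<in> space M"
    show "heat (c + a) h (walk n \<sigma> k \<omega>) - \<eta> \<le> indicator A \<omega>"
    proof (cases "\<omega> \<in> A")
      case True
      then show ?thesis using heat_bounds(2)[of "c + a" h "walk n \<sigma> k \<omega>"] \<eta> by simp
    next
      case False
      then have "a / sqrt h \<le> (c + a - walk n \<sigma> k \<omega>) / sqrt h"
        using \<open>0 < h\<close> \<open>\<omega> \<in> space M\<close> by (intro divide_right_mono) (auto simp: A_def)
      then have "heat (c + a) h (walk n \<sigma> k \<omega>) \<le> tail (a / sqrt h)"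
        unfolding heat_def by (rule tail_antimono)
      then have "heat (c + a) h (walk n \<sigma> k \<omega>) \<le> \<eta>" using upper by simp
      then show ?thesis using False by simp
    qed
  qed (intro Bochner_Integration.integrable_diff iA heat_int integrable_const)+
  then show "expectation (\<lambda>\<omega>. heat (c + a) h (walk n \<sigma> k \<omega>)) - \<eta> \<le> prob {\<omega> \<in> space M. c < walk n \<sigma> k \<omega>}"
    using heat_int unfolding A_def[symmetric] pA by (simp add: prob_space)
qed

lemma upper_tail_prob_eq:
  "upper_tail_prob M \<epsilon> lo hi c n = (SUP \<sigma>\<in>controls. prob {\<omega> \<in> space M. c < walk n \<sigma> n \<omega>})"
proof -
  have "sqrt (real n) * controlled_mean \<epsilon> \<sigma> n \<omega> = walk n \<sigma> n \<omega>" for \<sigma> \<omega>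
    by (cases "n = 0") (simp_all add: controlled_mean_def walk_def real_div_sqrt divide_simps
        real_sqrt_mult_self flip: real_sqrt_mult)
  then show ?thesis by (simp add: upper_tail_prob_def)
qed

text \<open>The upper estimate is uniform over controls and hence survives the supremum; for the
  lower one a single good control is enough.\<close>

lemma upper_tail_prob_bounds:
  assumes "0 < h" and "1 - \<eta> \<le> tail (- a / sqrt h)" and "tail (a / sqrt h) \<le> \<eta>"
  obtains B where
    "\<And>n. 0 < n \<Longrightarrow> upper_tail_prob M \<epsilon> lo hi c n \<le> tail ((c - a) / sqrt (1 + h)) + \<eta> + B / sqrt (real n)"
    "\<And>n. 0 < n \<Longrightarrow> tail ((c + a) / sqrt (1 + h)) - \<eta> - B / sqrt (real n) \<le> upper_tail_prob M \<epsilon> lo hi c n"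
proof -
  obtain B where "0 \<le> B" and
    up: "\<And>n c \<sigma>. 0 < n \<Longrightarrow> \<sigma> \<in> controls \<Longrightarrow>
      expectation (\<lambda>\<omega>. heat c h (walk n \<sigma> n \<omega>)) \<le> tail (c / sqrt (1 + h)) + B / sqrt (real n)" and
    low: "\<And>n c. 0 < n \<Longrightarrow>
      expectation (\<lambda>\<omega>. heat c h (walk n (feedback n c) n \<omega>)) \<ge> tail (c / sqrt (1 + h)) - B / sqrt (real n)"
    using heat_expectation_estimates[OF assms(1)] by blast
  note bounds = prob_walk_bounds[OF _ assms]
  show thesis
  proof (rule that)
    fix n :: nat assume n: "0 < n"
    show "upper_tail_prob M \<epsilon> lo hi c n \<le> tail ((c - a) / sqrt (1 + h)) + \<eta> + B / sqrt (real n)"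
      unfolding upper_tail_prob_eq
    proof (rule cSUP_least)
      show "controls \<noteq> {}" using feedback_controls by blast
      fix \<sigma> assume \<sigma>: "\<sigma> \<in> controls"
      show "prob {\<omega> \<in> space M. c < walk n \<sigma> n \<omega>} \<le> tail ((c - a) / sqrt (1 + h)) + \<eta> + B / sqrt (real n)"
        using up[OF n \<sigma>, of "c - a"] bounds(1)[OF \<sigma>, of c n n] by simp
    qed
    \<comment> \<open>The feedback must aim at c + a, the level of the smoothed indicator that lies
      below the sharp one up to \<open>\<eta>\<close>.\<close>
    have "prob {\<omega> \<in> space M. c < walk n (feedback n (c + a)) n \<omega>} \<le> upper_tail_prob M \<epsilon> lo hi c n"
      unfolding upper_tail_prob_eq
      by (rule cSUP_upper[OF feedback_controls]) (auto intro!: bdd_aboveI[of _ 1])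
    then show "tail ((c + a) / sqrt (1 + h)) - \<eta> - B / sqrt (real n) \<le> upper_tail_prob M \<epsilon> lo hi c n"
      using low[OF n, of "c + a"] bounds(2)[OF feedback_controls[of n "c + a"], of c n n] by simp
  qed
qed

text \<open>The choice h = r^4 and a = r gives a / sqrt h = 1 / r. As r tends to 0 from the right,
  this tends to infinity while shift and smoothing vanish. Since B depends on r, the value of r is
  fixed before n grows; the three parts of e pay for moving the argument of \<open>tail\<close>, for
  \<open>\<eta>\<close>, and for B / sqrt n.\<close>

lemma upper_tail_prob_tendsto: "upper_tail_prob M \<epsilon> lo hi c \<longlonglongrightarrow> tail c"
proof (rule LIMSEQ_I)
  fix e :: real assume e: "0 < e"
  have cont: "isCont tail x" for x using tail_has_derivative by (rule DERIV_isCont)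
  have "((\<lambda>r. tail ((c - r) / sqrt (1 + r ^ 4))) \<longlongrightarrow> tail ((c - 0) / sqrt (1 + 0 ^ 4))) (at_right 0)"
    by (intro isCont_tendsto_compose[OF cont] tendsto_intros) auto
  then have l1: "((\<lambda>r. tail ((c - r) / sqrt (1 + r ^ 4))) \<longlongrightarrow> tail c) (at_right 0)" by simp
  have "((\<lambda>r. tail ((c + r) / sqrt (1 + r ^ 4))) \<longlongrightarrow> tail ((c + 0) / sqrt (1 + 0 ^ 4))) (at_right 0)"
    by (intro isCont_tendsto_compose[OF cont] tendsto_intros) auto
  then have l2: "((\<lambda>r. tail ((c + r) / sqrt (1 + r ^ 4))) \<longlongrightarrow> tail c) (at_right 0)" by simp
  have l3: "((\<lambda>r. tail (inverse r)) \<longlongrightarrow> 0) (at_right 0)"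
    by (rule filterlim_compose[OF tail_limits(1) filterlim_inverse_at_top_right])
  have "filterlim (\<lambda>r::real. - inverse r) at_bot (at_right 0)"
    using filterlim_inverse_at_top_right by (simp add: filterlim_uminus_at_top)
  then have l4: "((\<lambda>r. tail (- inverse r)) \<longlongrightarrow> 1) (at_right 0)"
    by (rule filterlim_compose[OF tail_limits(2)])
  have "\<forall>\<^sub>F r in at_right 0. 0 < r \<and> dist (tail ((c - r) / sqrt (1 + r ^ 4))) (tail c) < e / 3 \<and>
      dist (tail ((c + r) / sqrt (1 + r ^ 4))) (tail c) < e / 3 \<and>
      dist (tail (inverse r)) 0 < e / 3 \<and> dist (tail (- inverse r)) 1 < e / 3"
    using e by (intro eventually_conj tendstoD[OF l1] tendstoD[OF l2] tendstoD[OF l3] tendstoD[OF l4])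
      (auto simp: eventually_at_right_less)
  then obtain r where r: "0 < r" "dist (tail ((c - r) / sqrt (1 + r ^ 4))) (tail c) < e / 3"
      "dist (tail ((c + r) / sqrt (1 + r ^ 4))) (tail c) < e / 3"
      "dist (tail (inverse r)) 0 < e / 3" "dist (tail (- inverse r)) 1 < e / 3"
    using eventually_happens' trivial_limit_at_right_real by blast
  have "sqrt (r ^ 4) = r\<^sup>2"
    using real_sqrt_power_even[of 4 r] r(1) by (simp add: real_sqrt_unique power_mult[symmetric])
  then have ri: "r / sqrt (r ^ 4) = inverse r" "- r / sqrt (r ^ 4) = - inverse r"
    using r(1) by (simp_all add: power2_eq_square field_simps)
  have "\<bar>tail (inverse r) - 0\<bar> < e / 3" "\<bar>tail (- inverse r) - 1\<bar> < e / 3"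
    using r(4,5) by (simp_all only: dist_real_def)
  then have "1 - e / 3 \<le> tail (- r / sqrt (r ^ 4))" "tail (r / sqrt (r ^ 4)) \<le> e / 3" "0 < r ^ 4"
    unfolding ri using r(1) by (linarith, linarith, simp)
  then obtain B where
    B: "\<And>n. 0 < n \<Longrightarrow> upper_tail_prob M \<epsilon> lo hi c n \<le> tail ((c - r) / sqrt (1 + r ^ 4)) + e / 3 + B / sqrt (real n)"
    "\<And>n. 0 < n \<Longrightarrow> tail ((c + r) / sqrt (1 + r ^ 4)) - e / 3 - B / sqrt (real n) \<le> upper_tail_prob M \<epsilon> lo hi c n"
    using upper_tail_prob_bounds[of "r ^ 4" "e / 3" r c] by blast
  have "(\<lambda>n. B / sqrt (real n)) \<longlonglongrightarrow> 0"
    by (intro real_tendsto_divide_at_top[OF tendsto_const]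
        filterlim_compose[OF sqrt_at_top filterlim_real_sequentially])
  then have "\<forall>\<^sub>F n in sequentially. dist (B / sqrt (real n)) 0 < e / 3"
    using e by (intro tendstoD) auto
  then obtain N where N: "\<And>n. N \<le> n \<Longrightarrow> \<bar>B / sqrt (real n)\<bar> < e / 3"
    by (auto simp: eventually_sequentially)
  have "norm (upper_tail_prob M \<epsilon> lo hi c n - tail c) < e" if "max N 1 \<le> n" for n
    using N[of n] B[of n] r(2,3) that unfolding dist_real_def real_norm_def
    by (simp only: abs_less_iff) linarith
  then show "\<exists>no. \<forall>n\<ge>no. norm (upper_tail_prob M \<epsilon> lo hi c n - tail c) < e" by blast
qed

end

theorem corollary1:
  fixes M :: "'a measure" and \<epsilon> :: "nat \<Rightarrow> 'a \<Rightarrow> real" and lo hi c :: real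
  assumes "iid_standardized M \<epsilon>"
    and "0 < lo" and "lo \<le> hi"
  shows "convergent (upper_tail_prob M \<epsilon> lo hi c) \<and>
    tail_capacity M \<epsilon> lo hi c =
      2 / (hi + lo) *
        (LINT z:{c<..}|lborel.
           std_normal_density (z / hi) * indicator {0..} z +
           std_normal_density (z / lo) * indicator {..<0} z)"
proof -
  interpret prob_space M using assms(1) by (simp add: iid_standardized_def)
  interpret controlled_walk M \<epsilon> lo hi using assms by unfold_locales
  have "tail c = 2 / (hi + lo) *
        (LINT z:{c<..}|lborel.
           std_normal_density (z / hi) * indicator {0..} z +
           std_normal_density (z / lo) * indicator {..<0} z)"
    unfolding tail_def profile_def ..
  then show ?thesis
    using upper_tail_prob_tendsto[of c] unfolding tail_capacity_def
    by (auto intro: convergentI dest: limI)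
qed

end
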